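(* Let $\Omega\subset\mathbb{R}^n$ be a bounded domain. For $1<q<p<\infty$ let $$\Lambda_{p,q}(\Omega) = \inf\left\{\int_\Omega |\nabla u|^p\,dx \;:\; u\in W^{1,p}_0(\Omega),\ \|u\|_{L^q(\Omega)}=1\right\},$$ and let $$\lambda_{1,\infty}(\Omega)=\inf_{u\in W^{1,\infty}_0(\Omega)\setminus\{0\}}\frac{\|\nabla u\|_{L^\infty(\Omega)}}{\|u\|_{L^\infty(\Omega)}}.$$ Then $$\lim_{p,q\to\infty}\sqrt[p]{\Lambda_{p,q}(\Omega)}=\lambda_{1,\infty}(\Omega),$$ where the limit is taken over pairs $(p,q)$ with $1<q<p$ and both $p\to\infty$ and $q\to\infty$ (no condition is imposed on the relative rates of divergence of $p$ and $q$).
   Context: A domain is a connected open set. $W^{1,\infty}_0(\Omega)$ denotes the functions in $W^{1,\infty}(\Omega)$ which (in their continuous representative) extend continuously by $0$ to $\partial\Omega$. The number $\lambda_{1,\infty}(\Omega)$ (the first $\infty$-eigenvalue) also equals $\lim_{p\to\infty}\sqrt[p]{\lambda_{1,p}(\Omega)}$, where $\lambda_{1,p}(\Omega)=\inf_{u\in W^{1,p}_0(\Omega)\setminus\{0\}}\int_\Omega|\nabla u|^p dx\big/\int_\Omega|u|^p dx$, and it equals $1/\mathfrak{R}$, where $\mathfrak{R}$ is the radius of the biggest ball contained in $\Omega$. *)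

theory Defs
  imports "HOL-Analysis.Analysis" "HOL-Probability.Essential_Supremum"
begin

section \<open>Lebesgue spaces\<close>

text \<open>Elements of \<open>L\<^sup>p\<close> are represented by functions; only the values almost everywhere matter.\<close>

definition Lp_space :: "real \<Rightarrow> 'a measure \<Rightarrow> ('a \<Rightarrow> 'b::euclidean_space) set" where
  "Lp_space p M = {f \<in> borel_measurable M. integrable M (\<lambda>x. norm (f x) powr p)}"

definition Lp_norm :: "real \<Rightarrow> 'a measure \<Rightarrow> ('a \<Rightarrow> 'b::euclidean_space) \<Rightarrow> real" where
  "Lp_norm p M f = (LINT x|M. norm (f x) powr p) powr (1 / p)"

definition Linf_space :: "'a measure \<Rightarrow> ('a \<Rightarrow> 'b::euclidean_space) set" where
  "Linf_space M = {f \<in> borel_measurable M. esssup M (\<lambda>x. ereal (norm (f x))) < \<infinity>}"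

definition Linf_norm :: "'a measure \<Rightarrow> ('a \<Rightarrow> 'b::euclidean_space) \<Rightarrow> real" where
  "Linf_norm M f = real_of_ereal (esssup M (\<lambda>x. ereal (norm (f x))))"


section \<open>Test functions and weak gradients\<close>

primrec Ck_fun :: "nat \<Rightarrow> ('a::euclidean_space \<Rightarrow> real) \<Rightarrow> bool" where
  "Ck_fun 0 f \<longleftrightarrow> continuous_on UNIV f"
| "Ck_fun (Suc k) f \<longleftrightarrow>
     (\<forall>x. f differentiable (at x)) \<and> (\<forall>b\<in>Basis. Ck_fun k (\<lambda>x. frechet_derivative f (at x) b))"

definition test_fun :: "'a::euclidean_space set \<Rightarrow> ('a \<Rightarrow> real) \<Rightarrow> bool" where
  "test_fun \<Omega> \<phi> \<longleftrightarrow>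
     (\<forall>k. Ck_fun k \<phi>) \<and> compact (closure {x. \<phi> x \<noteq> 0}) \<and> closure {x. \<phi> x \<noteq> 0} \<subseteq> \<Omega>"

definition gradient :: "('a::euclidean_space \<Rightarrow> real) \<Rightarrow> 'a \<Rightarrow> 'a" where
  "gradient f x = (\<Sum>b\<in>Basis. frechet_derivative f (at x) b *\<^sub>R b)"

text \<open>The weak gradient is unique up to a null set, hence it is treated as a relation.\<close>

definition has_weak_gradient ::
    "'a::euclidean_space set \<Rightarrow> ('a \<Rightarrow> real) \<Rightarrow> ('a \<Rightarrow> 'a) \<Rightarrow> bool" where
  "has_weak_gradient \<Omega> u g \<longleftrightarrow>
     (\<forall>K. compact K \<and> K \<subseteq> \<Omega> \<longrightarrow> u absolutely_integrable_on K \<and> g absolutely_integrable_on K) \<and>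
     (\<forall>\<phi>. test_fun \<Omega> \<phi> \<longrightarrow>
        (LINT x|lebesgue_on \<Omega>. u x *\<^sub>R gradient \<phi> x) = - (LINT x|lebesgue_on \<Omega>. \<phi> x *\<^sub>R g x))"


section \<open>Sobolev spaces\<close>

definition W1p :: "real \<Rightarrow> 'a::euclidean_space set \<Rightarrow> ('a \<Rightarrow> real) set" where
  "W1p p \<Omega> = {u \<in> Lp_space p (lebesgue_on \<Omega>).
     \<exists>g \<in> Lp_space p (lebesgue_on \<Omega>). has_weak_gradient \<Omega> u g}"

text \<open>The closure of the test functions in the \<open>W\<^sup>1\<^sup>,\<^sup>p\<close> norm.\<close>

definition W1p_0 :: "real \<Rightarrow> 'a::euclidean_space set \<Rightarrow> ('a \<Rightarrow> real) set" where
  "W1p_0 p \<Omega> = {u \<in> W1p p \<Omega>. \<exists>g \<in> Lp_space p (lebesgue_on \<Omega>). \<exists>\<phi>.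
     has_weak_gradient \<Omega> u g \<and> (\<forall>k::nat. test_fun \<Omega> (\<phi> k)) \<and>
     (\<lambda>k. Lp_norm p (lebesgue_on \<Omega>) (\<lambda>x. \<phi> k x - u x)) \<longlonglongrightarrow> 0 \<and>
     (\<lambda>k. Lp_norm p (lebesgue_on \<Omega>) (\<lambda>x. gradient (\<phi> k) x - g x)) \<longlonglongrightarrow> 0}"

definition W1inf :: "'a::euclidean_space set \<Rightarrow> ('a \<Rightarrow> real) set" where
  "W1inf \<Omega> = {u \<in> Linf_space (lebesgue_on \<Omega>).
     \<exists>g \<in> Linf_space (lebesgue_on \<Omega>). has_weak_gradient \<Omega> u g}"

text \<open>Functions whose continuous representative extends continuously by zero to the boundary
  (not the closure of the test functions in the \<open>W\<^sup>1\<^sup>,\<^sup>\<infinity>\<close> norm).\<close>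

definition W1inf_0 :: "'a::euclidean_space set \<Rightarrow> ('a \<Rightarrow> real) set" where
  "W1inf_0 \<Omega> = {u \<in> W1inf \<Omega>. \<exists>v. continuous_on (closure \<Omega>) v \<and>
     (AE x in lebesgue_on \<Omega>. u x = v x) \<and> (\<forall>x\<in>frontier \<Omega>. v x = 0)}"


section \<open>The variational quantities\<close>

definition Lambda_pq :: "real \<Rightarrow> real \<Rightarrow> 'a::euclidean_space set \<Rightarrow> real" where
  "Lambda_pq p q \<Omega> = Inf {LINT x|lebesgue_on \<Omega>. norm (g x) powr p | u g.
     u \<in> W1p_0 p \<Omega> \<and> g \<in> Lp_space p (lebesgue_on \<Omega>) \<and>
     has_weak_gradient \<Omega> u g \<and> Lp_norm q (lebesgue_on \<Omega>) u = 1}"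

definition lambda_1inf :: "'a::euclidean_space set \<Rightarrow> real" where
  "lambda_1inf \<Omega> = Inf {Linf_norm (lebesgue_on \<Omega>) g / Linf_norm (lebesgue_on \<Omega>) u | u g.
     u \<in> W1inf_0 \<Omega> \<and> g \<in> Linf_space (lebesgue_on \<Omega>) \<and>
     has_weak_gradient \<Omega> u g \<and> \<not> (AE x in lebesgue_on \<Omega>. u x = 0)}"

end

theory Submission
  imports Defs
begin

text \<open>The limit and \<open>\<lambda>\<^sub>1\<^sub>,\<^sub>\<infinity>\<close> both equal the reciprocal of the inradius \<open>R\<close>, the largest distance of a point of \<open>\<Omega>\<close> from
the complement of \<open>\<Omega>\<close>.

The bounds that use a competitor come from one family of test functions: the cone
\<open>max 0 (\<rho> - \<bar>x - x\<^sub>0\<bar>)\<close> over a ball contained in \<open>\<Omega>\<close>, mollified. It has slope at most 1, and its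
height is close to \<open>R\<close> on a small ball of measure \<open>\<mu>\<close> (\<open>smooth_cone_exists\<close>). It shows
\<open>\<lambda>\<^sub>1\<^sub>,\<^sub>\<infinity> \<le> 1/R\<close>, and for every \<open>r < R\<close> it shows
\<open>\<Lambda>\<^sub>p\<^sub>,\<^sub>q powr (1/p) \<le> \<bar>\<Omega>\<bar> powr (1/p) / (r \<mu> powr (1/q))\<close>, whose limit is \<open>1/r\<close>.

For \<open>\<lambda>\<^sub>1\<^sub>,\<^sub>\<infinity> \<ge> 1/R\<close>, mollification shows that a function with a bounded weak gradient is Lipschitz along
the segments in \<open>\<Omega>\<close>, the constant being the bound \<open>M\<close> of the gradient. Following the segment from \<open>x\<close>
to the nearest boundary point, where the function vanishes, gives \<open>\<bar>u x\<bar> \<le> M R\<close>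
(\<open>Linf_norm_le_inradius\<close>).

The lower bound for \<open>\<Lambda>\<^sub>p\<^sub>,\<^sub>q\<close> is a Morrey inequality whose constant tends to \<open>R\<close>, which replaces a compactness
argument for minimizers. Let \<open>\<phi>\<close> be a test function, \<open>x \<in> \<Omega>\<close>, and \<open>z\<close> the nearest point outside \<open>\<Omega>\<close>. Instead of the
segment from \<open>x\<close> to \<open>z\<close>, a null set in dimension above 1, where an \<open>L\<^sup>p\<close> bound on \<open>\<nabla>\<phi>\<close> says nothing, take the broken lines
\<open>x, w, z\<close> where \<open>w\<close> runs through a box of size \<open>\<delta>\<close> at the midpoint. All of them have
length at most \<open>R + 2\<delta>\<close>, and at time \<open>t\<close> the points \<open>x + t(w - x)\<close> fill a box of volume \<open>t\<^sup>n\<close> times that of the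
original one. So the mean over \<open>w\<close> of \<open>\<bar>\<nabla>\<phi>\<bar>\<close> at time \<open>t\<close> is at most a constant that tends to 1 as \<open>p \<longrightarrow> \<infinity>\<close>,
times \<open>t powr (-n/p) \<parallel>\<nabla>\<phi>\<parallel>\<^sub>p\<close>, and integrating over \<open>t\<close> costs a factor \<open>1/(1 - n/p)\<close>. Altogether
\<open>\<parallel>\<phi>\<parallel>\<^sub>\<infinity> \<le> (R + 2\<delta>) c(\<delta>,p) \<parallel>\<nabla>\<phi>\<parallel>\<^sub>p\<close> with \<open>c(\<delta>,p) \<longrightarrow> 1\<close> as \<open>p \<longrightarrow> \<infinity>\<close>
(\<open>morrey_estimate\<close>, \<open>pointwise_bound\<close>). The estimate passes to the closure
\<open>W\<^sup>1\<^sup>,\<^sup>p\<^sub>0\<close> of the test functions, with any weak gradient of the limit because weak gradients are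
unique (\<open>weak_gradient_unique\<close>). Since \<open>\<parallel>u\<parallel>\<^sub>q \<le> \<bar>\<Omega>\<bar> powr (1/q) \<parallel>u\<parallel>\<^sub>\<infinity>\<close>, it bounds \<open>\<Lambda>\<^sub>p\<^sub>,\<^sub>q powr (1/p)\<close> from below by
a quantity with limit \<open>1/(R + 2\<delta>)\<close>. In each of these bounds, \<open>p\<close> and \<open>q\<close> occur in separate factors
with separate limits, so their relative rates do not matter.\<close>

section \<open>Smooth functions\<close>

abbreviation smooth :: "('a::euclidean_space \<Rightarrow> real) \<Rightarrow> bool" where
  "smooth f \<equiv> \<forall>k. Ck_fun k f"

lemma Ck_fun_SucD: "Ck_fun (Suc k) f \<Longrightarrow> Ck_fun k f"
proof (induction k arbitrary: f)
  case 0
  then show ?case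
    by (auto simp: continuous_on_eq_continuous_at intro: differentiable_imp_continuous_within)
qed auto

text \<open>The recursive clause of \<open>Ck_fun\<close> refers to \<open>frechet_derivative\<close>, a choice operator. This form lets any
known formula for the derivative take its place.\<close>

lemma Ck_fun_Suc_iff:
  assumes "\<And>x. (f has_derivative f' x) (at x)"
  shows "Ck_fun (Suc k) f \<longleftrightarrow> (\<forall>b\<in>Basis. Ck_fun k (\<lambda>x. f' x b))"
proof -
  have "frechet_derivative f (at x) = f' x" for x
    using frechet_derivative_at[OF assms] by simp
  then show ?thesis using assms by (auto simp: differentiable_def)
qed

lemma Ck_fun_has_derivative:
  "Ck_fun (Suc k) f \<Longrightarrow> (f has_derivative frechet_derivative f (at x)) (at x)"
  by (simp add: frechet_derivative_works[symmetric])

lemma Ck_fun_zero: "Ck_fun k (\<lambda>x. 0)"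
  by (induction k) (auto simp: frechet_derivative_const)

lemma Ck_fun_const: "Ck_fun k (\<lambda>x. c)"
  by (cases k) (auto simp: frechet_derivative_const Ck_fun_zero)

lemma Ck_fun_inner: "Ck_fun k (\<lambda>x. x \<bullet> b)"
proof (cases k)
  case (Suc m)
  have "((\<lambda>x. x \<bullet> b) has_derivative (\<lambda>h. h \<bullet> b)) (at x)" for x
    by (auto intro!: derivative_eq_intros)
  from Ck_fun_Suc_iff[OF this] show ?thesis using Suc Ck_fun_const by blast
qed (auto intro!: continuous_intros)

lemma Ck_fun_add: "Ck_fun k f \<Longrightarrow> Ck_fun k g \<Longrightarrow> Ck_fun k (\<lambda>x. f x + g x)"
proof (induction k arbitrary: f g)
  case (Suc k)
  have "((\<lambda>x. f x + g x) has_derivative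
      (\<lambda>h. frechet_derivative f (at x) h + frechet_derivative g (at x) h)) (at x)" for x
    using Suc.prems by (intro has_derivative_add Ck_fun_has_derivative)
  from Ck_fun_Suc_iff[OF this] show ?case using Suc by auto
qed (auto intro!: continuous_intros)

lemma Ck_fun_mult: "Ck_fun k f \<Longrightarrow> Ck_fun k g \<Longrightarrow> Ck_fun k (\<lambda>x. f x * g x)"
proof (induction k arbitrary: f g)
  case (Suc k)
  have "((\<lambda>x. f x * g x) has_derivative
      (\<lambda>h. f x * frechet_derivative g (at x) h + frechet_derivative f (at x) h * g x)) (at x)" for x
    using Suc.prems by (intro has_derivative_mult Ck_fun_has_derivative)
  from Ck_fun_Suc_iff[OF this]
  have "Ck_fun (Suc k) (\<lambda>x. f x * g x) \<longleftrightarrow> (\<forall>b\<in>Basis. Ck_fun k (\<lambda>x.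
      f x * frechet_derivative g (at x) b + frechet_derivative f (at x) b * g x))" .
  moreover have "Ck_fun k f" "Ck_fun k g" using Suc.prems Ck_fun_SucD by blast+
  ultimately show ?case using Suc by (auto intro!: Ck_fun_add)
qed (auto intro!: continuous_intros)

lemma Ck_fun_translate: "Ck_fun k f \<Longrightarrow> Ck_fun k (\<lambda>x. f (x - a))"
proof (induction k arbitrary: f)
  case 0
  then show ?case by (auto intro!: continuous_on_compose2[of UNIV f] continuous_intros)
next
  case (Suc k)
  have "((\<lambda>x. f (x - a)) has_derivative (\<lambda>h. frechet_derivative f (at (x - a)) h)) (at x)" for x
    by (rule has_derivative_compose[of "\<lambda>x. x - a" "\<lambda>h. h" x UNIV f, simplified])
      (use Suc.prems in \<open>auto intro!: derivative_eq_intros Ck_fun_has_derivative\<close>)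
  from Ck_fun_Suc_iff[OF this] show ?case using Suc by auto
qed

lemma smooth_derivative: "smooth f \<Longrightarrow> b \<in> Basis \<Longrightarrow> smooth (\<lambda>x. frechet_derivative f (at x) b)"
  by (metis Ck_fun.simps(2))

lemma smooth_continuous: "smooth f \<Longrightarrow> continuous_on A f"
  by (metis Ck_fun.simps(1) continuous_on_subset subset_UNIV)

lemma smooth_gradient:
  assumes "smooth f"
  shows "GDERIV f x :> gradient f x"
proof -
  have d: "(f has_derivative frechet_derivative f (at x)) (at x)"
    using assms Ck_fun_has_derivative by blast
  interpret linear "frechet_derivative f (at x)" using d by (rule has_derivative_linear)
  have "frechet_derivative f (at x) h = h \<bullet> gradient f x" for h
  proof -
    have "frechet_derivative f (at x) h = frechet_derivative f (at x) (\<Sum>b\<in>Basis. (h \<bullet> b) *\<^sub>R b)"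
      by (simp add: euclidean_representation)
    also have "\<dots> = h \<bullet> gradient f x"
      by (simp add: sum scale gradient_def inner_sum_right mult.commute)
    finally show ?thesis .
  qed
  then show ?thesis using d unfolding gderiv_def by (metis (no_types, lifting) ext)
qed

lemma continuous_on_gradient:
  assumes "smooth f" shows "continuous_on A (gradient f)"
  unfolding gradient_def
  by (intro continuous_intros smooth_continuous smooth_derivative assms)

lemma frechet_derivative_eq_gradient:
  "smooth f \<Longrightarrow> frechet_derivative f (at x) h = h \<bullet> gradient f x"
  using smooth_gradient[of f x] frechet_derivative_at[of f "\<lambda>h. h \<bullet> gradient f x" x]
  unfolding gderiv_def by metis

text \<open>The germ of the standard bump function, with a polynomial weight so that the family is closed
under differentiation: differentiating \<open>P(1/t) exp(-1/t)\<close> replaces \<open>P\<close> by \<open>X\<^sup>2 (P - P')\<close>.\<close>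

definition flat :: "real poly \<Rightarrow> real \<Rightarrow> real" where
  "flat P t = (if t > 0 then poly P (1 / t) * exp (- (1 / t)) else 0)"

lemma flat_tendsto_0: "((\<lambda>t. flat P t) \<longlongrightarrow> 0) (at_right 0)"
proof -
  have "((\<lambda>x. poly P x / exp x) \<longlongrightarrow> 0) at_top"
  proof -
    have "((\<lambda>x::real. \<Sum>i\<le>degree P. coeff P i * (x ^ i / exp x)) \<longlongrightarrow> (\<Sum>i\<le>degree P. coeff P i * 0)) at_top"
      by (intro tendsto_intros tendsto_power_div_exp_0)
    then show ?thesis by (simp add: poly_altdef sum_divide_distrib)
  qed
  then have "((\<lambda>t. poly P (inverse t) / exp (inverse t)) \<longlongrightarrow> 0) (at_right 0)"
    by (rule filterlim_compose[OF _ filterlim_inverse_at_top_right])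
  then show ?thesis
    by (rule Lim_transform_eventually)
      (auto simp: flat_def eventually_at_filter exp_minus field_simps inverse_eq_divide)
qed

text \<open>At the origin the difference quotient of \<open>flat P\<close> is \<open>flat (X P)\<close>, which tends to 0 because the exponential
beats every polynomial.\<close>

lemma flat_has_derivative:
  "(flat P has_real_derivative flat ([:0,0,1:] * (P - pderiv P)) t) (at t)"
proof -
  consider "t > 0" | "t < 0" | "t = 0" by linarith
  then show ?thesis
  proof cases
    case 1
    have "((\<lambda>t. poly P (1 / t) * exp (- (1 / t))) has_real_derivative
        flat ([:0,0,1:] * (P - pderiv P)) t) (at t)"
      using 1 by (auto intro!: derivative_eq_intros DERIV_chain2[where f="poly P"] poly_DERIV
          simp: flat_def field_simps power2_eq_square)
    then show ?thesis
      by (rule has_field_derivative_transform_within_open[where S="{0<..}"])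
        (use 1 in \<open>auto simp: flat_def\<close>)
  next
    case 2
    have "((\<lambda>t. 0) has_real_derivative flat ([:0,0,1:] * (P - pderiv P)) t) (at t)"
      using 2 by (auto simp: flat_def)
    then show ?thesis
      by (rule has_field_derivative_transform_within_open[where S="{..<0}"])
        (use 2 in \<open>auto simp: flat_def\<close>)
  next
    case 3
    have "((\<lambda>y. (flat P y - flat P 0) / (y - 0)) \<longlongrightarrow> 0) (at 0)"
      unfolding filterlim_at_split
    proof
      show "((\<lambda>y. (flat P y - flat P 0) / (y - 0)) \<longlongrightarrow> 0) (at_left 0)"
        by (rule Lim_transform_eventually[OF tendsto_const])
          (auto simp: flat_def eventually_at_filter)
      show "((\<lambda>y. (flat P y - flat P 0) / (y - 0)) \<longlongrightarrow> 0) (at_right 0)"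
        by (rule Lim_transform_eventually[OF flat_tendsto_0[of "[:0,1:] * P"]])
          (auto simp: flat_def eventually_at_filter)
    qed
    then show ?thesis using 3 by (simp add: has_field_derivative_iff flat_def)
  qed
qed

text \<open>Induction on \<open>k\<close> for all weights at once, since a derivative changes the weight.\<close>

lemma smooth_flat_compose_paraboloid: "Ck_fun k (\<lambda>x. flat P (c - x \<bullet> x))"
proof (induction k arbitrary: P)
  case 0
  have "continuous_on UNIV (flat P)"
    by (rule DERIV_continuous_on[of UNIV _ "flat ([:0,0,1:] * (P - pderiv P))"])
      (rule flat_has_derivative)
  then show ?case by (auto intro!: continuous_on_compose2[of UNIV "flat P"] continuous_intros)
next
  case (Suc k)
  let ?Q = "[:0,0,1:] * (P - pderiv P)"
  have "((\<lambda>x. flat P (c - x \<bullet> x)) has_derivative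
    (\<lambda>h. flat ?Q (c - x \<bullet> x) * (- 2 * (x \<bullet> h)))) (at x)" for x :: 'a
  proof -
    have "((\<lambda>x. c - x \<bullet> x) has_derivative (\<lambda>h. - 2 * (x \<bullet> h))) (at x)"
      by (auto intro!: derivative_eq_intros simp: inner_commute)
    from has_derivative_compose[OF this flat_has_derivative[of P "c - x \<bullet> x",
      unfolded has_field_derivative_def]]
    show ?thesis .
  qed
  note step = Ck_fun_Suc_iff[OF this]
  have "Ck_fun k (\<lambda>x. flat ?Q (c - x \<bullet> x) * (- 2 * (x \<bullet> b)))" for b :: 'a
    by (intro Ck_fun_mult Ck_fun_const Ck_fun_inner Suc)
  then show ?case unfolding step by blast
qed

section \<open>Integrals of compactly supported functions\<close>

lemma compact_support_integrable:
  fixes f :: "'a::euclidean_space \<Rightarrow> 'b::euclidean_space"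
  assumes "continuous_on UNIV f" "compact K" "\<And>x. x \<notin> K \<Longrightarrow> f x = 0"
  shows "integrable lborel f"
proof -
  have "integrable lborel (\<lambda>x. indicator K x *\<^sub>R f x)"
    by (rule borel_integrable_compact) (use assms continuous_on_subset[OF assms(1)] in auto)
  also have "(\<lambda>x. indicator K x *\<^sub>R f x) = f"
    using assms(3) by (auto simp: indicator_def fun_eq_iff)
  finally show ?thesis .
qed

lemma compact_support_integral:
  fixes f :: "'a::euclidean_space \<Rightarrow> 'b::euclidean_space"
  assumes "continuous_on UNIV f" "\<And>x. x \<notin> cbox a b \<Longrightarrow> f x = 0"
  shows "integral\<^sup>L lborel f = integral (cbox a b) f"
proof -
  have "set_integrable lborel (cbox a b) f"
    unfolding set_integrable_def
    by (rule borel_integrable_compact) (use assms continuous_on_subset[OF assms(1)] in auto)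
  from set_borel_integral_eq_integral(2)[OF this]
  have "(LINT x|lborel. indicator (cbox a b) x *\<^sub>R f x) = integral (cbox a b) f"
    by (simp add: set_lebesgue_integral_def)
  also have "(\<lambda>x. indicator (cbox a b) x *\<^sub>R f x) = f"
    using assms(2) by (auto simp: indicator_def fun_eq_iff)
  finally show ?thesis .
qed

lemma lborel_integral_affine:
  fixes f :: "'a::euclidean_space \<Rightarrow> 'b::euclidean_space"
  assumes [measurable]: "f \<in> borel_measurable borel" and "c \<noteq> 0"
  shows "integral\<^sup>L lborel f = \<bar>c\<bar> ^ DIM('a) *\<^sub>R (LBINT x. f (t + c *\<^sub>R x))"
proof -
  have "integral\<^sup>L lborel f
      = integral\<^sup>L (density (distr lborel borel (\<lambda>x. t + c *\<^sub>R x)) (\<lambda>_. ennreal (\<bar>c\<bar>^DIM('a)))) f"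
    using lborel_affine[OF assms(2), of t] by (simp add: ennreal_power)
  also have "\<dots> = integral\<^sup>L (distr lborel borel (\<lambda>x. t + c *\<^sub>R x)) (\<lambda>x. \<bar>c\<bar>^DIM('a) *\<^sub>R f x)"
    by (rule integral_density) auto
  also have "\<dots> = (LBINT x. \<bar>c\<bar>^DIM('a) *\<^sub>R f (t + c *\<^sub>R x))"
    by (rule integral_distr) auto
  finally show ?thesis by simp
qed

lemma lborel_integral_translation:
  fixes f :: "'a::euclidean_space \<Rightarrow> 'b::euclidean_space"
  assumes "f \<in> borel_measurable borel"
  shows "(LBINT x. f (t + x)) = integral\<^sup>L lborel f"
  using lborel_integral_affine[OF assms, of 1 t] by simp

section \<open>Differentiation under the integral sign\<close>

text \<open>Off the closed set \<open>K\<close> the function vanishes on a whole neighbourhood.\<close>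

lemma GDERIV_outside_support:
  assumes "closed K" "\<And>x. x \<notin> K \<Longrightarrow> f x = 0" "x \<notin> K" "GDERIV f x :> g"
  shows "g = 0"
proof -
  have "((\<lambda>_. 0::real) has_derivative (\<lambda>h. h \<bullet> g)) (at x)"
    by (rule has_derivative_transform_within_open[where s="-K" and f=f])
      (use assms in \<open>auto simp: gderiv_def open_Compl intro: has_derivative_eq_rhs\<close>)
  from has_derivative_unique[OF this has_derivative_const] have "g \<bullet> g = 0" by metis
  then show ?thesis by simp
qed

text \<open>Differentiation under the integral sign puts the derivative on the compactly supported factor. The
constant weight 1 yields integration by parts, a general continuous weight yields mollification.\<close>

lemma GDERIV_correlation:
  fixes w f :: "'a::euclidean_space \<Rightarrow> real"
  assumes w: "continuous_on UNIV w" and f: "\<And>x. GDERIV f x :> G x"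
    and G: "continuous_on UNIV G" and supp: "\<And>x. x \<notin> cball 0 r \<Longrightarrow> f x = 0"
  shows "GDERIV (\<lambda>x. LBINT y. w y * f (y - x)) x :> - (LBINT y. w y *\<^sub>R G (y - x))"
proof -
  have suppG: "G x = 0" if "x \<notin> cball 0 r" for x
    using GDERIV_outside_support[OF _ supp that f] by simp
  have fc: "continuous_on UNIV f"
    using f by (auto simp: gderiv_def continuous_on_eq_continuous_at intro: has_derivative_continuous)
  obtain c where c: "cball x (r + 1) \<subseteq> cbox (-c) c"
    using bounded_subset_cbox_symmetric[OF bounded_cball] by blast
  have out: "y - x' \<notin> cball 0 r" if "x' \<in> ball x 1" "y \<notin> cbox (-c) c" for x' y
  proof -
    have "norm (y - x) > r + 1" using subsetD[OF c, of y] that(2) by (fastforce simp: dist_norm norm_minus_commute)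
    moreover have "norm (y - x) \<le> norm (y - x') + norm (x' - x)"
      using norm_triangle_ineq[of "y - x'" "x' - x"] by simp
    moreover have "norm (x' - x) < 1" using that(1) by (simp add: dist_norm norm_minus_commute)
    ultimately show ?thesis by (simp add: norm_minus_commute)
  qed
  have cf: "continuous_on A (\<lambda>y. w y * f (y - x'))" for x' A
    by (intro continuous_intros continuous_on_compose2[OF fc] continuous_on_subset[OF w]) auto
  have cG: "continuous_on A (\<lambda>y. w y *\<^sub>R G (y - x'))" for x' A
    by (intro continuous_intros continuous_on_compose2[OF G] continuous_on_subset[OF w]) auto
  define D where "D x' y = blinfun_inner_left (- (w y *\<^sub>R G (y - x')))" for x' y
  have "((\<lambda>x. integral (cbox (-c) c) (\<lambda>y. w y * f (y - x))) has_derivative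
      blinfun_apply (integral (cbox (-c) c) (D x))) (at x within ball x 1)"
  proof (rule leibniz_rule)
    fix x' y
    have "((\<lambda>x. f (y - x)) has_derivative (\<lambda>h. (- h) \<bullet> G (y - x'))) (at x')"
      by (rule has_derivative_compose[of "\<lambda>x. y - x" "\<lambda>h. - h" x' UNIV f, simplified])
        (use f[of "y - x'"] in \<open>auto simp: gderiv_def intro!: derivative_eq_intros\<close>)
    from has_derivative_mult_right[OF this, of "w y"]
    have "((\<lambda>x. w y * f (y - x)) has_derivative blinfun_apply (D x' y)) (at x')"
      unfolding D_def by (simp add: inner_commute)
    then show "((\<lambda>x. w y * f (y - x)) has_derivative blinfun_apply (D x' y)) (at x' within ball x 1)"
      by (rule has_derivative_at_withinI)
  next
    show "continuous_on (ball x 1 \<times> cbox (- c) c) (\<lambda>(x, y). D x y)"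
      unfolding D_def case_prod_beta
      by (intro bounded_linear.continuous_on[OF bounded_linear_blinfun_inner_left] continuous_intros
          continuous_on_compose2[OF w] continuous_on_compose2[OF G]) auto
  qed (auto intro: integrable_continuous cf)
  then have "((\<lambda>x. integral (cbox (-c) c) (\<lambda>y. w y * f (y - x))) has_derivative
      blinfun_apply (integral (cbox (-c) c) (D x))) (at x)"
    by (subst (asm) at_within_open) auto
  then have "((\<lambda>x. LBINT y. w y * f (y - x)) has_derivative
      blinfun_apply (integral (cbox (-c) c) (D x))) (at x)"
    by (rule has_derivative_transform_within_open[where s="ball x 1"])
      (use out in \<open>force intro!: compact_support_integral[symmetric] cf supp\<close>)+
  moreover have "integral (cbox (-c) c) (D x)
      = blinfun_inner_left (integral (cbox (-c) c) (\<lambda>y. - (w y *\<^sub>R G (y - x))))"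
    unfolding D_def
    by (rule integral_linear[OF _ bounded_linear_blinfun_inner_left, unfolded o_def])
      (intro integrable_continuous continuous_intros cG)
  moreover have "(LBINT y. w y *\<^sub>R G (y - x)) = integral (cbox (-c) c) (\<lambda>y. w y *\<^sub>R G (y - x))"
    by (rule compact_support_integral) (use out[of x] in \<open>force intro!: cG suppG\<close>)+
  ultimately show ?thesis
    by (simp add: gderiv_def)
qed

lemma smooth_correlation:
  assumes w: "continuous_on UNIV w" and f: "smooth f" and supp: "\<And>x. x \<notin> cball 0 r \<Longrightarrow> f x = 0"
  shows "Ck_fun k (\<lambda>x. LBINT y. w y * f (y - x))"
  using f supp
proof (induction k arbitrary: f)
  case 0
  have "continuous_on UNIV (\<lambda>x. LBINT y. w y * f (y - x))"
    using GDERIV_correlation[OF w smooth_gradient[OF 0(1)] continuous_on_gradient[OF 0(1)] 0(2)]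
    by (auto simp: gderiv_def continuous_on_eq_continuous_at intro!: has_derivative_continuous)
  then show ?case by simp
next
  case (Suc k)
  note f = Suc.prems(1)
  note D = GDERIV_correlation[OF w smooth_gradient[OF f] continuous_on_gradient[OF f] Suc.prems(2)]
  have gsupp: "gradient f x = 0" if "x \<notin> cball 0 r" for x
    using GDERIV_outside_support[OF _ Suc.prems(2) that smooth_gradient[OF f]] by simp
  have comp: "b \<bullet> - (LBINT y. w y *\<^sub>R gradient f (y - x))
      = - 1 * (LBINT y. w y * frechet_derivative f (at (y - x)) b)" for x b
  proof -
    have "continuous_on UNIV (\<lambda>y. w y *\<^sub>R gradient f (y - x))"
      by (intro continuous_intros w continuous_on_compose2[OF continuous_on_gradient[OF f, of UNIV]]) auto
    then have "integrable lborel (\<lambda>y. w y *\<^sub>R gradient f (y - x))"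
    proof (rule compact_support_integrable[where K="cball x r"])
      fix y assume "y \<notin> cball x r"
      then show "w y *\<^sub>R gradient f (y - x) = 0"
        using gsupp[of "y - x"] by (simp add: dist_norm norm_minus_commute)
    qed simp
    then show ?thesis
      using integral_inner_right[of b lborel "\<lambda>y. w y *\<^sub>R gradient f (y - x)"]
      by (simp add: frechet_derivative_eq_gradient[OF f])
  qed
  have "((\<lambda>x. LBINT y. w y * f (y - x)) has_derivative
      (\<lambda>h. h \<bullet> - (LBINT y. w y *\<^sub>R gradient f (y - x)))) (at x)" for x
    using D by (simp add: gderiv_def)
  note step = Ck_fun_Suc_iff[OF this]
  show ?case
  proof (rule iffD2[OF step], unfold comp)
    show "\<forall>b\<in>Basis. Ck_fun k (\<lambda>x. - 1 * (LBINT y. w y * frechet_derivative f (at (y - x)) b))"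
    proof (intro ballI Ck_fun_mult Ck_fun_const Suc.IH)
      fix b :: 'a assume b: "b \<in> Basis"
      show "smooth (\<lambda>x. frechet_derivative f (at x) b)" by (rule smooth_derivative[OF f b])
      show "frechet_derivative f (at x) b = 0" if "x \<notin> cball 0 r" for x
        by (simp add: frechet_derivative_eq_gradient[OF f] gsupp[OF that])
    qed
  qed
qed

section \<open>A Morrey inequality with an asymptotically sharp constant\<close>

text \<open>Hoelder's inequality against the constant 1, for a box. It is obtained by integrating the pointwise Young
inequality \<open>y \<le> l powr (1 - p) / p * y powr p + (1 - 1/p) * l\<close>.\<close>

lemma integral_powr_le:
  fixes f :: "'a::euclidean_space \<Rightarrow> real"
  assumes f: "continuous_on (cbox a b) f" "\<And>x. x \<in> cbox a b \<Longrightarrow> 0 \<le> f x"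
    and V: "measure lborel (cbox a b) > 0" and p: "p \<ge> 1" and N: "N > 0"
    and le: "integral (cbox a b) (\<lambda>x. f x powr p) \<le> N powr p"
  shows "integral (cbox a b) f \<le> measure lborel (cbox a b) powr (1 - 1 / p) * N"
proof -
  let ?E = "cbox a b" let ?V = "measure lborel ?E"
  \<comment> \<open>The weight for which Young's inequality becomes an equality if \<open>f\<close> is constant and \<open>N\<close> is sharp.\<close>
  define l where "l = N * ?V powr (- (1 / p))"
  have l: "l > 0" using V N by (simp add: l_def)
  have lp: "l powr p = N powr p / ?V"
  proof -
    have "l powr p = N powr p * ?V powr (- 1)"
      using V N p by (simp add: l_def powr_mult powr_powr)
    then show ?thesis using V by (simp add: powr_minus_divide)
  qed
  have young: "y \<le> l powr (1 - p) / p * y powr p + (1 - 1 / p) * l" if "y \<ge> 0" for y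
  proof (cases "y = 0")
    case False
    then have y: "y > 0" using that by simp
    have "(y powr p * l powr (1 - p)) powr (1 / p) * l powr (1 - 1 / p)
        \<le> 1 / p * (y powr p * l powr (1 - p)) + (1 - 1 / p) * l"
      by (rule Youngs_inequality_0) (use y l p in auto)
    also have "(y powr p * l powr (1 - p)) powr (1 / p) * l powr (1 - 1 / p)
        = y * l powr ((1 - p) / p + (1 - 1 / p))"
      using y p by (simp add: powr_mult powr_powr powr_add)
    also have "(1 - p) / p + (1 - 1 / p) = 0" using p by (simp add: field_simps)
    finally show ?thesis using l by (simp add: mult_ac)
  qed (use l p in simp)
  have i1: "f integrable_on ?E" by (rule integrable_continuous[OF f(1)])
  have i2: "(\<lambda>x. f x powr p) integrable_on ?E"
    by (intro integrable_continuous continuous_on_powr' f continuous_intros) (use f p in auto)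
  have i3: "(\<lambda>x. l powr (1 - p) / p * f x powr p) integrable_on ?E"
    using integrable_cmul[OF i2, of "l powr (1 - p) / p"] by simp
  have "integral ?E f \<le> integral ?E (\<lambda>x. l powr (1 - p) / p * f x powr p + (1 - 1 / p) * l)"
    by (intro integral_le i1 integrable_add i3 integrable_const young f(2))
  also have "\<dots> = l powr (1 - p) / p * integral ?E (\<lambda>x. f x powr p) + ?V * ((1 - 1 / p) * l)"
    using integral_add[OF i3 integrable_const]
    by simp
  also have "\<dots> \<le> l powr (1 - p) / p * N powr p + ?V * ((1 - 1 / p) * l)"
    using le p by (intro add_right_mono mult_left_mono) auto
  also have "N powr p = l powr p * ?V" using lp V by simp
  also have "l powr (1 - p) / p * (l powr p * ?V) = ?V * l / p"
    using l by (simp add: field_simps flip: powr_add)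
  also have "?V * l / p + ?V * ((1 - 1 / p) * l) = ?V * l" using p by (simp add: field_simps)
  also have "\<dots> = ?V powr (1 - 1 / p) * N"
    using V by (simp add: l_def powr_diff powr_minus_divide)
  finally show ?thesis .
qed

text \<open>Contract the box \<open>E\<close> towards \<open>x\<close>. The integral \<open>A t\<close> of \<open>\<phi>\<close> over the points \<open>x + t (w - x)\<close>, \<open>w \<in> E\<close>, interpolates
between \<open>\<bar>E\<bar> \<phi> x\<close> and the integral of \<open>\<phi>\<close> over \<open>E\<close>. At time \<open>t\<close> the box has shrunk by \<open>t\<close> in every direction, so
Hoelder's inequality and a change of variables give \<open>\<bar>A' t\<bar> \<le> L \<bar>E\<bar> powr (1 - 1/p) N t powr (-n/p)\<close>,
and this is integrable at 0 because \<open>p > n\<close>.\<close>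

lemma morrey_estimate:
  fixes \<phi> :: "'a::euclidean_space \<Rightarrow> real"
  assumes \<phi>: "\<And>x. GDERIV \<phi> x :> G x" and G: "continuous_on UNIV G"
    and supp: "\<And>x. x \<notin> cball 0 r \<Longrightarrow> \<phi> x = 0"
    and V: "measure lborel (cbox a b) > 0" and L: "\<And>w. w \<in> cbox a b \<Longrightarrow> norm (w - x) \<le> L"
    and p: "p > real DIM('a)" and N: "N > 0" "(LBINT y. norm (G y) powr p) \<le> N powr p"
  shows "\<bar>integral (cbox a b) \<phi> - measure lborel (cbox a b) * \<phi> x\<bar>
    \<le> L * measure lborel (cbox a b) powr (1 - 1 / p) * N / (1 - DIM('a) / p)"
proof -
  let ?E = "cbox a b" let ?V = "measure lborel ?E" let ?n = "real DIM('a)"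
  have p1: "p > 1" using p DIM_positive[where 'a='a] by linarith
  have suppG: "G y = 0" if "y \<notin> cball 0 r" for y
    using GDERIV_outside_support[OF _ supp that \<phi>] by simp
  have cphi: "continuous_on A \<phi>" for A
    using \<phi> by (auto simp: gderiv_def intro!: continuous_at_imp_continuous_on has_derivative_continuous)
  have L0: "0 \<le> L" using L V by (metis content_empty ex_in_conv less_irrefl norm_ge_zero order_trans)
  define A where "A t = integral ?E (\<lambda>w. \<phi> (x + t *\<^sub>R (w - x)))" for t
  define A' where "A' t = integral ?E (\<lambda>w. (w - x) \<bullet> G (x + t *\<^sub>R (w - x)))" for t
  have contA': "continuous_on S (\<lambda>(t, w). (w - x) \<bullet> G (x + t *\<^sub>R (w - x)))" for S :: "(real \<times> 'a) set"
    unfolding case_prod_beta by (intro continuous_intros continuous_on_compose2[OF G]) auto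
  have contG: "continuous_on S (\<lambda>w. G (x + t *\<^sub>R (w - x)))" for S t
    by (intro continuous_intros continuous_on_compose2[OF G]) auto
  have A: "(A has_vector_derivative A' t) (at t)" for t
  proof -
    have "(A has_vector_derivative A' t) (at t within UNIV)"
      unfolding A_def A'_def
    proof (rule leibniz_rule_vector_derivative)
      fix t w
      have "((\<lambda>t. x + t *\<^sub>R (w - x)) has_derivative (\<lambda>s. s *\<^sub>R (w - x))) (at t)"
        by (auto intro!: derivative_eq_intros)
      from has_derivative_compose[OF this \<phi>[unfolded gderiv_def]]
      show "((\<lambda>t. \<phi> (x + t *\<^sub>R (w - x))) has_vector_derivative
          (w - x) \<bullet> G (x + t *\<^sub>R (w - x))) (at t within UNIV)"
        by (simp add: has_vector_derivative_def)
    qed (auto intro!: integrable_continuous contA' continuous_on_compose2[OF cphi[of UNIV]] continuous_intros)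
    then show ?thesis by simp
  qed
  have scaled: "integral ?E (\<lambda>w. norm (G (x + t *\<^sub>R (w - x))) powr p) \<le> (N * t powr (- ?n / p)) powr p"
    if t: "0 < t" for t
  proof -
    let ?h = "\<lambda>w. norm (G (x + t *\<^sub>R (w - x))) powr p"
    have ch: "continuous_on S ?h" for S
      by (intro continuous_on_powr' continuous_intros contG) (use p1 in auto)
    have hint: "integrable lborel ?h"
    proof (rule compact_support_integrable[OF ch])
      show "compact (cball x ((r + norm x) / t))" by simp
      fix w assume "w \<notin> cball x ((r + norm x) / t)"
      then have "r + norm x < t * norm (w - x)"
        using t by (simp add: dist_norm norm_minus_commute field_simps)
      also have "\<dots> = norm (t *\<^sub>R (w - x))" using t by simp
      finally have "r + norm x < norm (t *\<^sub>R (w - x))" .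
      then have "r < norm (x + t *\<^sub>R (w - x))"
        using norm_triangle_ineq4[of "x + t *\<^sub>R (w - x)" x] by simp
      then show "?h w = 0" using suppG[of "x + t *\<^sub>R (w - x)"] by simp
    qed
    have "integral ?E ?h \<le> integral UNIV ?h"
      using integrable_on_lborel[OF hint]
      by (intro integral_subset_le integrable_continuous ch) auto
    also have "\<dots> = (LBINT w. ?h w)" using integral_lborel[OF hint] by simp
    also have "\<dots> = t powr (- ?n) * (LBINT y. norm (G y) powr p)"
    proof -
      have "(\<lambda>y. norm (G y) powr p) \<in> borel_measurable borel"
        by (intro borel_measurable_continuous_onI continuous_on_powr' continuous_intros G) (use p1 in auto)
      from lborel_integral_affine[OF this, of t "x - t *\<^sub>R x"] t
      have "(LBINT y. norm (G y) powr p) = t powr ?n * (LBINT w. ?h w)"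
        by (simp add: powr_realpow algebra_simps)
      then show ?thesis using t by (simp add: powr_minus field_simps)
    qed
    also have "\<dots> \<le> t powr (- ?n) * N powr p"
      using N by (intro mult_left_mono) auto
    also have "\<dots> = (N * t powr (- ?n / p)) powr p"
      using N t p1 by (simp add: powr_mult powr_powr)
    finally show ?thesis .
  qed
  have A'_le: "norm (A' t) \<le> L * ?V powr (1 - 1 / p) * N * t powr (- ?n / p)" if t: "0 < t" for t
  proof -
    have "norm (A' t) \<le> integral ?E (\<lambda>w. L * norm (G (x + t *\<^sub>R (w - x))))"
      unfolding A'_def
    proof (rule integral_norm_bound_integral)
      fix w assume "w \<in> ?E"
      then have "norm (w - x) * norm (G (x + t *\<^sub>R (w - x))) \<le> L * norm (G (x + t *\<^sub>R (w - x)))"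
        using L by (intro mult_right_mono) auto
      then show "norm ((w - x) \<bullet> G (x + t *\<^sub>R (w - x))) \<le> L * norm (G (x + t *\<^sub>R (w - x)))"
        using Cauchy_Schwarz_ineq2[of "w - x" "G (x + t *\<^sub>R (w - x))"] by simp
    qed (auto intro!: integrable_continuous continuous_intros contG)
    also have "\<dots> = L * integral ?E (\<lambda>w. norm (G (x + t *\<^sub>R (w - x))))" by simp
    also have "\<dots> \<le> L * (?V powr (1 - 1 / p) * (N * t powr (- ?n / p)))"
      by (intro mult_left_mono integral_powr_le continuous_intros contG V scaled t L0)
        (use p1 N t in auto)
    finally show ?thesis by (simp add: mult_ac)
  qed
  \<comment> \<open>Compare \<open>A\<close> with the antiderivative \<open>K t powr s / s\<close>, which is continuous up to 0 since \<open>s > 0\<close>.\<close>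
  define s where "s = 1 - ?n / p"
  have s: "s > 0" using p p1 by (simp add: s_def)
  define K where "K = L * ?V powr (1 - 1 / p) * N"
  have "norm (A 1 - A 0) \<le> K * 1 powr s / s - K * 0 powr s / s"
  proof (rule differentiable_bound_general)
    show "continuous_on {0..1} A"
      using A by (intro continuous_at_imp_continuous_on) (auto intro: has_vector_derivative_continuous)
    show "continuous_on {0..1} (\<lambda>t. K * t powr s / s)"
      by (intro continuous_intros continuous_on_powr') (use s in auto)
    show "(A has_vector_derivative A' t) (at t)" for t by (rule A)
    fix t :: real assume t: "0 < t" "t < 1"
    have "((\<lambda>t. K * t powr s / s) has_real_derivative K * t powr (s - 1)) (at t)"
      using t s by (auto intro!: derivative_eq_intros)
    then show "((\<lambda>t. K * t powr s / s) has_vector_derivative K * t powr (s - 1)) (at t)"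
      by (simp add: has_real_derivative_iff_has_vector_derivative)
    show "norm (A' t) \<le> K * t powr (s - 1)" using A'_le[OF t(1)] by (simp add: K_def s_def)
  qed simp
  moreover have "A 1 = integral ?E \<phi>" "A 0 = ?V * \<phi> x" by (simp_all add: A_def)
  ultimately show ?thesis using s by (simp add: K_def s_def)
qed

text \<open>The constant of the Morrey inequality for a box that fits in a ball of radius \<open>\<delta>\<close>, apart from the length of
the paths. The type argument only carries the dimension.\<close>

definition box_factor :: "'a::euclidean_space itself \<Rightarrow> real \<Rightarrow> real \<Rightarrow> real" where
  "box_factor _ \<delta> p = measure lborel (cbox 0 ((\<delta> / DIM('a)) *\<^sub>R (One::'a))) powr (- 1 / p) / (1 - DIM('a) / p)"

text \<open>The Morrey inequality is applied twice, at \<open>x\<close> and at the zero \<open>z\<close>, with one box that has a corner at their midpoint. Each of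
its points is within \<open>R/2 + \<delta>\<close> of \<open>x\<close> and of \<open>z\<close>; the two halves add up to the path length \<open>R + 2 \<delta>\<close>.\<close>

lemma pointwise_bound:
  fixes \<phi> :: "'a::euclidean_space \<Rightarrow> real"
  assumes \<phi>: "\<And>x. GDERIV \<phi> x :> G x" and G: "continuous_on UNIV G"
    and supp: "\<And>x. x \<notin> cball 0 r \<Longrightarrow> \<phi> x = 0"
    and z: "\<phi> z = 0" "norm (x - z) \<le> R" and \<delta>: "\<delta> > 0"
    and p: "p > real DIM('a)" and N: "N > 0" "(LBINT y. norm (G y) powr p) \<le> N powr p"
  shows "\<bar>\<phi> x\<bar> \<le> (R + 2 * \<delta>) * box_factor TYPE('a) \<delta> p * N"
proof -
  define m where "m = midpoint x z"
  let ?n = "real DIM('a)"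
  \<comment> \<open>By the \<open>l\<^sup>1\<close> bound for the norm, the diameter of a box with edges \<open>\<delta> / n\<close> is at most \<open>\<delta>\<close>.\<close>
  let ?c = "(\<delta> / ?n) *\<^sub>R (One::'a)"
  let ?E = "cbox m (m + ?c)"
  define V where "V = measure lborel ?E"
  have V_eq: "V = measure lborel (cbox 0 ?c)"
    unfolding V_def using \<delta> by (subst (1 2) content_cbox) (auto simp: inner_simps)
  have n: "?n > 0" by simp
  have V: "V > 0"
    unfolding V_eq using \<delta> n by (intro content_pos_lt) (auto simp: inner_simps)
  have close: "norm (w - m) \<le> \<delta>" if "w \<in> ?E" for w
  proof -
    have "\<bar>(w - m) \<bullet> i\<bar> \<le> \<delta> / ?n" if "i \<in> Basis" for i
      using \<open>w \<in> ?E\<close> that by (fastforce simp: mem_box inner_simps)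
    then have "norm (w - m) \<le> (\<Sum>i\<in>(Basis::'a set). \<delta> / ?n)"
      by (intro order_trans[OF norm_le_l1] sum_mono) auto
    then show ?thesis by simp
  qed
  define L where "L = R / 2 + \<delta>"
  have Lx: "norm (w - x) \<le> L" if "w \<in> ?E" for w
    using close[OF that] z(2) norm_triangle_ineq[of "w - m" "m - x"]
      dist_midpoint(3)[of x z] by (simp add: L_def m_def dist_norm)
  have Lz: "norm (w - z) \<le> L" if "w \<in> ?E" for w
    using close[OF that] z(2) norm_triangle_ineq[of "w - m" "m - z"]
      dist_midpoint(4)[of x z] by (simp add: L_def m_def dist_norm)
  have M: "\<bar>integral ?E \<phi> - V * \<phi> y\<bar> \<le> L * V powr (1 - 1 / p) * N / (1 - ?n / p)"
    if "\<And>w. w \<in> ?E \<Longrightarrow> norm (w - y) \<le> L" for y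
    unfolding V_def by (rule morrey_estimate[OF \<phi> G supp V[unfolded V_def] that p N])
  have "V * \<bar>\<phi> x\<bar> = \<bar>V * \<phi> x\<bar>" using V by (simp add: abs_mult)
  also have "\<dots> \<le> 2 * (L * V powr (1 - 1 / p) * N / (1 - ?n / p))"
    using M[of x, OF Lx] M[of z, OF Lz] z by simp
  also have "V powr (1 - 1 / p) = V * V powr (- 1 / p)"
    using V by (simp add: powr_diff powr_minus_divide)
  finally have "V * \<bar>\<phi> x\<bar> \<le> V * ((2 * L) * V powr (- 1 / p) / (1 - ?n / p) * N)"
    by (simp add: mult_ac)
  then have "\<bar>\<phi> x\<bar> \<le> (2 * L) * V powr (- 1 / p) / (1 - ?n / p) * N"
    using V by (simp only: mult_le_cancel_left_pos)
  then show ?thesis by (simp add: L_def V_eq box_factor_def)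
qed

section \<open>Mollification\<close>

definition mollifier :: "real \<Rightarrow> ('a::euclidean_space \<Rightarrow> real) \<Rightarrow> bool" where
  "mollifier \<delta> \<eta> \<longleftrightarrow> smooth \<eta> \<and> (\<forall>x. 0 \<le> \<eta> x) \<and> (\<forall>x. x \<notin> cball 0 \<delta> \<longrightarrow> \<eta> x = 0) \<and>
     integrable lborel \<eta> \<and> integral\<^sup>L lborel \<eta> = 1"

lemma mollifier_exists:
  assumes "\<delta> > 0"
  obtains \<eta> :: "'a::euclidean_space \<Rightarrow> real" where "mollifier \<delta> \<eta>"
proof -
  define f :: "'a \<Rightarrow> real" where "f x = flat 1 (\<delta>\<^sup>2 - x \<bullet> x)" for x
  have smooth: "smooth f" unfolding f_def using smooth_flat_compose_paraboloid by blast
  have nonneg: "0 \<le> f x" for x by (simp add: f_def flat_def)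
  have supp: "f x = 0" if "x \<notin> cball 0 \<delta>" for x
  proof -
    have "\<delta>\<^sup>2 \<le> (norm x)\<^sup>2" using that assms by (intro power_mono) auto
    then show ?thesis by (simp add: f_def flat_def dot_square_norm)
  qed
  have cont: "continuous_on UNIV f" by (rule smooth_continuous[OF smooth])
  have int: "integrable lborel f" by (rule compact_support_integrable[OF cont compact_cball supp])
  obtain c where c: "cball (0::'a) \<delta> \<subseteq> box (-c) c"
    using bounded_subset_box_symmetric[OF bounded_cball] by blast
  have eq: "integral\<^sup>L lborel f = integral (cbox (-c) c) f"
    using c supp box_subset_cbox[of "-c" c] by (intro compact_support_integral[OF cont]) blast
  have "integral\<^sup>L lborel f \<noteq> 0"
  proof
    assume "integral\<^sup>L lborel f = 0"
    moreover have cc: "continuous_on (cbox (-c) c) f" using cont continuous_on_subset by blast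
    ultimately have "(f has_integral 0) (cbox (-c) c)"
      using integrable_continuous[OF cc] eq by (metis integrable_integral)
    moreover have "0 \<in> box (-c) c" using c assms by (metis centre_in_cball less_imp_le subsetD)
    ultimately have "f 0 = 0"
      using has_integral_0_cbox_imp_0[OF cc nonneg] box_subset_cbox by blast
    then show False using assms by (simp add: f_def flat_def)
  qed
  moreover have "integral\<^sup>L lborel f \<ge> 0" by (simp add: nonneg)
  ultimately have pos: "integral\<^sup>L lborel f > 0" by simp
  show ?thesis
  proof
    have "smooth (\<lambda>x. inverse (integral\<^sup>L lborel f) * f x)"
      using smooth by (auto intro!: Ck_fun_mult Ck_fun_const)
    then show "mollifier \<delta> (\<lambda>x. inverse (integral\<^sup>L lborel f) * f x)"
      using supp pos nonneg int by (auto simp: mollifier_def)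
  qed
qed

text \<open>The correlation with \<open>\<eta>\<close>, not the convolution: the kernel \<open>y \<mapsto> \<eta> (y - x)\<close> is then a mere translate of \<open>\<eta>\<close>,
hence a test function without any symmetry of \<open>\<eta>\<close>.\<close>

definition mollify :: "('a::euclidean_space \<Rightarrow> real) \<Rightarrow> ('a \<Rightarrow> real) \<Rightarrow> 'a \<Rightarrow> real" where
  "mollify \<eta> v x = (LBINT y. v y * \<eta> (y - x))"

text \<open>All quantitative properties of mollification below are instances: \<open>F\<close> is the difference of two translates of
the mollified function, or of a translate and a constant.\<close>

lemma mollifier_average_bound:
  assumes \<eta>: "mollifier \<delta> \<eta>" and F: "continuous_on UNIV F"
    and bound: "\<And>z. norm z \<le> \<delta> \<Longrightarrow> \<bar>F z\<bar> \<le> e"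
  shows "\<bar>LBINT z. F z * \<eta> z\<bar> \<le> e"
proof -
  have "continuous_on UNIV \<eta>" using \<eta> smooth_continuous by (auto simp: mollifier_def)
  then have "integrable lborel (\<lambda>z. F z * \<eta> z)"
    using \<eta> by (intro compact_support_integrable[OF _ compact_cball[of 0 \<delta>]] continuous_intros F)
      (auto simp: mollifier_def)
  then have "norm (LBINT z. F z * \<eta> z) \<le> (LBINT z. e * \<eta> z)"
  proof (rule Bochner_Integration.integral_norm_bound_integral)
    show "integrable lborel (\<lambda>z. e * \<eta> z)" using \<eta> by (simp add: mollifier_def)
    show "norm (F z * \<eta> z) \<le> e * \<eta> z" for z
      using \<eta> bound[of z]
      by (cases "norm z \<le> \<delta>") (auto simp: mollifier_def abs_mult intro!: mult_right_mono)
  qed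
  then show ?thesis using \<eta> by (simp add: mollifier_def)
qed

lemma mollify_translated:
  assumes \<eta>: "mollifier \<delta> \<eta>" and v: "continuous_on UNIV v"
  shows "mollify \<eta> v x = (LBINT z. v (x + z) * \<eta> z)"
proof -
  have c: "continuous_on UNIV \<eta>" using \<eta> smooth_continuous by (auto simp: mollifier_def)
  have "(\<lambda>y. v y * \<eta> (y - x)) \<in> borel_measurable borel"
    by (intro borel_measurable_continuous_onI continuous_intros v continuous_on_compose2[OF c]) auto
  from lborel_integral_translation[OF this, of x] show ?thesis by (simp add: mollify_def)
qed

lemma mollify_integrable:
  assumes \<eta>: "mollifier \<delta> \<eta>" and v: "continuous_on UNIV v"
  shows "integrable lborel (\<lambda>z. v (x + z) * \<eta> z)"
proof -
  have "continuous_on UNIV \<eta>" using \<eta> smooth_continuous by (auto simp: mollifier_def)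
  then show ?thesis
    using \<eta> by (intro compact_support_integrable[OF _ compact_cball[of 0 \<delta>]]
        continuous_intros continuous_on_compose2[OF v])
      (auto simp: mollifier_def)
qed

lemma mollify_close:
  assumes \<eta>: "mollifier \<delta> \<eta>" and v: "continuous_on UNIV v"
    and bound: "\<And>z. norm z \<le> \<delta> \<Longrightarrow> \<bar>v (x + z) - c\<bar> \<le> e"
  shows "\<bar>mollify \<eta> v x - c\<bar> \<le> e"
proof -
  have "(LBINT z. (v (x + z) - c) * \<eta> z) = mollify \<eta> v x - c"
    using \<eta> mollify_integrable[OF \<eta> v, of x]
    by (simp add: left_diff_distrib mollify_translated[OF \<eta> v] mollifier_def)
  moreover have "\<bar>LBINT z. (v (x + z) - c) * \<eta> z\<bar> \<le> e"
    by (intro mollifier_average_bound[OF \<eta>] bound continuous_intros continuous_on_compose2[OF v]) auto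
  ultimately show ?thesis by simp
qed

lemma mollify_lipschitz:
  assumes \<eta>: "mollifier \<delta> \<eta>" and v: "continuous_on UNIV v"
    and lip: "\<And>x y. \<bar>v x - v y\<bar> \<le> C * norm (x - y)"
  shows "\<bar>mollify \<eta> v x - mollify \<eta> v y\<bar> \<le> C * norm (x - y)"
proof -
  have "(LBINT z. (v (x + z) - v (y + z)) * \<eta> z) = mollify \<eta> v x - mollify \<eta> v y"
    using mollify_integrable[OF \<eta> v]
    by (simp add: left_diff_distrib mollify_translated[OF \<eta> v])
  moreover have "\<bar>LBINT z. (v (x + z) - v (y + z)) * \<eta> z\<bar> \<le> C * norm (x - y)"
    using lip[of "x + z" "y + z" for z]
    by (intro mollifier_average_bound[OF \<eta>] continuous_intros continuous_on_compose2[OF v]) auto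
  ultimately show ?thesis by simp
qed

lemma smooth_mollify:
  assumes "mollifier \<delta> \<eta>" "continuous_on UNIV v"
  shows "smooth (mollify \<eta> v)"
  using smooth_correlation[OF assms(2), of \<eta> \<delta>] assms(1) by (auto simp: mollifier_def mollify_def[abs_def])

lemma mollify_support:
  assumes \<eta>: "mollifier \<delta> \<eta>" and v: "continuous_on UNIV v"
    and supp: "\<And>y. y \<notin> K \<Longrightarrow> v y = 0" and "mollify \<eta> v x \<noteq> 0"
  obtains y where "y \<in> K" "dist y x \<le> \<delta>"
proof -
  have "\<exists>z. norm z \<le> \<delta> \<and> v (x + z) \<noteq> 0"
    using mollify_close[OF \<eta> v, of x 0 0] assms(4) by auto
  then obtain z where "norm z \<le> \<delta>" "x + z \<in> K" using supp by blast
  then show ?thesis using that[of "x + z"] by (simp add: dist_norm)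
qed

lemma test_fun_mollify:
  assumes \<eta>: "mollifier \<delta> \<eta>" and v: "continuous_on UNIV v"
    and supp: "\<And>y. y \<notin> K \<Longrightarrow> v y = 0" and K': "compact K'" "K' \<subseteq> \<Omega>"
    and sub: "\<And>x y. y \<in> K \<Longrightarrow> dist y x \<le> \<delta> \<Longrightarrow> x \<in> K'"
  shows "test_fun \<Omega> (mollify \<eta> v)"
proof -
  have "closure {x. mollify \<eta> v x \<noteq> 0} \<subseteq> K'"
    using mollify_support[OF \<eta> v supp] sub
    by (intro closure_minimal compact_imp_closed K') (auto, metis)
  then show ?thesis
    using smooth_mollify[OF \<eta> v] K' compact_closure[of "{x. mollify \<eta> v x \<noteq> 0}"]
      bounded_subset[OF compact_imp_bounded[OF K'(1)] subset_trans[OF closure_subset]]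
    by (auto simp: test_fun_def)
qed

section \<open>Weak gradients of test functions\<close>

lemma test_funE:
  assumes "test_fun \<Omega> \<phi>"
  obtains K r where "smooth \<phi>" "compact K" "K \<subseteq> \<Omega>" "\<And>x. x \<notin> K \<Longrightarrow> \<phi> x = 0"
    "\<And>x. x \<notin> K \<Longrightarrow> gradient \<phi> x = 0" "K \<subseteq> cball 0 r"
proof -
  let ?K = "closure {x. \<phi> x \<noteq> 0}"
  have s: "smooth \<phi>" and K: "compact ?K" "?K \<subseteq> \<Omega>" using assms by (auto simp: test_fun_def)
  have z: "\<phi> x = 0" if "x \<notin> ?K" for x
    using that subsetD[OF closure_subset[of "{x. \<phi> x \<noteq> 0}"], of x] by blast
  obtain r where "?K \<subseteq> cball 0 r"
    using compact_imp_bounded[OF K(1)] by (metis bounded_subset_ballD ball_subset_cball order_trans)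
  show ?thesis
    by (rule that[OF s K z GDERIV_outside_support[OF closed_closure z _ smooth_gradient[OF s]] \<open>?K \<subseteq> cball 0 r\<close>])
qed

lemma lebesgue_on_integral_eq:
  fixes f :: "'a::euclidean_space \<Rightarrow> 'b::euclidean_space"
  assumes "\<Omega> \<in> sets lebesgue" "f \<in> borel_measurable borel" "\<And>x. x \<notin> \<Omega> \<Longrightarrow> f x = 0"
  shows "integral\<^sup>L (lebesgue_on \<Omega>) f = integral\<^sup>L lborel f"
    and "integrable (lebesgue_on \<Omega>) f \<longleftrightarrow> integrable lborel f"
proof -
  have eq: "(\<lambda>x. indicator \<Omega> x *\<^sub>R f x) = f"
    using assms(3) by (auto simp: indicator_def fun_eq_iff)
  show "integral\<^sup>L (lebesgue_on \<Omega>) f = integral\<^sup>L lborel f"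
    using assms(1,2) by (subst integral_restrict_space) (auto simp: eq integral_completion)
  show "integrable (lebesgue_on \<Omega>) f \<longleftrightarrow> integrable lborel f"
    using assms(1,2) by (subst integrable_restrict_space) (auto simp: eq integrable_completion)
qed

lemma GDERIV_unique: "GDERIV f x :> g \<Longrightarrow> GDERIV f x :> g' \<Longrightarrow> g = g'"
  unfolding gderiv_def by (metis has_derivative_unique inner_commute vector_eq_rdot)

lemma absolutely_integrable_on_compact:
  fixes f :: "'a::euclidean_space \<Rightarrow> 'b::euclidean_space"
  assumes "compact K" "continuous_on K f"
  shows "f absolutely_integrable_on K"
  using borel_integrable_compact[OF assms]
  by (auto simp: set_integrable_def integrable_completion)

text \<open>The integral is invariant under translation of \<open>f\<close>, so its derivative with respect to the translation
vanishes; that derivative is minus the integral of the gradient.\<close>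

lemma GDERIV_integral_0:
  fixes f :: "'a::euclidean_space \<Rightarrow> real"
  assumes "\<And>x. GDERIV f x :> G x" "continuous_on UNIV G" "\<And>x. x \<notin> cball 0 r \<Longrightarrow> f x = 0"
  shows "(LBINT y. G y) = 0"
proof -
  have c: "continuous_on UNIV f"
    using assms(1) by (auto simp: gderiv_def intro!: continuous_at_imp_continuous_on has_derivative_continuous)
  have "f \<in> borel_measurable borel" by (rule borel_measurable_continuous_onI[OF c])
  from lborel_integral_translation[OF this, of "- x" for x]
  have "(\<lambda>x. LBINT y. 1 * f (y - x)) = (\<lambda>x. integral\<^sup>L lborel f)" by (auto simp: fun_eq_iff)
  moreover have "GDERIV (\<lambda>x. LBINT y. 1 * f (y - x)) 0 :> - (LBINT y. 1 *\<^sub>R G (y - 0))"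
    by (rule GDERIV_correlation[OF continuous_on_const assms])
  ultimately have "GDERIV (\<lambda>x. integral\<^sup>L lborel f) (0::'a) :> - (LBINT y. G y)"
    by simp
  moreover have "GDERIV (\<lambda>x. integral\<^sup>L lborel f) (0::'a) :> 0" by (rule GDERIV_const)
  ultimately show ?thesis
    using GDERIV_unique by (metis neg_equal_0_iff_equal)
qed

text \<open>Integration by parts: the gradient of the product of two test functions integrates to 0.\<close>

lemma test_fun_weak_gradient:
  assumes \<Omega>: "open \<Omega>" and u: "test_fun \<Omega> u"
  shows "has_weak_gradient \<Omega> u (gradient u)"
proof -
  obtain K r where u: "smooth u" "compact K" "K \<subseteq> \<Omega>" "\<And>x. x \<notin> K \<Longrightarrow> u x = 0"
      "\<And>x. x \<notin> K \<Longrightarrow> gradient u x = 0" "K \<subseteq> cball 0 r" using test_funE[OF u] by metis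
  have cu: "continuous_on A u" "continuous_on A (gradient u)" for A
    using u(1) by (auto intro: smooth_continuous continuous_on_gradient)
  have "(LINT x|lebesgue_on \<Omega>. u x *\<^sub>R gradient \<phi> x) = - (LINT x|lebesgue_on \<Omega>. \<phi> x *\<^sub>R gradient u x)"
    if "test_fun \<Omega> \<phi>" for \<phi>
  proof -
    have s: "smooth \<phi>" using that by (simp add: test_fun_def)
    have c\<phi>: "continuous_on A \<phi>" "continuous_on A (gradient \<phi>)" for A
      using s by (auto intro: smooth_continuous continuous_on_gradient)
    have out: "u x = 0" "gradient u x = 0" if "x \<notin> \<Omega>" for x
      using u(4,5)[of x] subsetD[OF u(3), of x] that by auto
    have i1: "integrable lborel (\<lambda>x. u x *\<^sub>R gradient \<phi> x)"
      by (rule compact_support_integrable[OF _ u(2)]; simp add: u(4,5) continuous_on_scaleR cu c\<phi>)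
    have i2: "integrable lborel (\<lambda>x. \<phi> x *\<^sub>R gradient u x)"
      by (rule compact_support_integrable[OF _ u(2)]; simp add: u(4,5) continuous_on_scaleR cu c\<phi>)
    have "(LBINT x. u x *\<^sub>R gradient \<phi> x + \<phi> x *\<^sub>R gradient u x) = 0"
    proof (rule GDERIV_integral_0)
      show "GDERIV (\<lambda>x. u x * \<phi> x) x :> u x *\<^sub>R gradient \<phi> x + \<phi> x *\<^sub>R gradient u x" for x
        by (intro GDERIV_mult smooth_gradient u s)
      show "u x * \<phi> x = 0" if "x \<notin> cball 0 r" for x
        using u(4)[of x] subsetD[OF u(6), of x] that by auto
    qed (intro continuous_intros cu c\<phi>)
    then have "(LBINT x. u x *\<^sub>R gradient \<phi> x) = - (LBINT x. \<phi> x *\<^sub>R gradient u x)"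
      using i1 i2 by (simp add: eq_neg_iff_add_eq_0)
    moreover have "(LINT x|lebesgue_on \<Omega>. u x *\<^sub>R gradient \<phi> x) = (LBINT x. u x *\<^sub>R gradient \<phi> x)"
      by (intro lebesgue_on_integral_eq(1) borel_measurable_continuous_onI continuous_intros cu c\<phi>)
        (use out \<Omega> in simp_all)
    moreover have "(LINT x|lebesgue_on \<Omega>. \<phi> x *\<^sub>R gradient u x) = (LBINT x. \<phi> x *\<^sub>R gradient u x)"
      by (intro lebesgue_on_integral_eq(1) borel_measurable_continuous_onI continuous_intros cu c\<phi>)
        (use out \<Omega> in simp_all)
    ultimately show ?thesis by simp
  qed
  then show ?thesis
    unfolding has_weak_gradient_def using absolutely_integrable_on_compact cu by metis
qed

section \<open>Uniqueness of weak gradients\<close>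

lemma integrable_lebesgue_on_scaleR:
  fixes h :: "'a::euclidean_space \<Rightarrow> 'b::euclidean_space"
  assumes \<Omega>: "\<Omega> \<in> sets lebesgue" and K: "K \<subseteq> \<Omega>" and h: "h absolutely_integrable_on K"
    and v: "v \<in> borel_measurable borel" "\<And>x. \<bar>v x\<bar> \<le> B" "\<And>x. x \<notin> K \<Longrightarrow> v x = 0"
  shows "integrable (lebesgue_on \<Omega>) (\<lambda>x. v x *\<^sub>R h x)"
proof -
  have i: "integrable lebesgue (\<lambda>x. indicator K x *\<^sub>R h x)"
    using h by (simp add: set_integrable_def)
  have "integrable lebesgue (\<lambda>x. v x *\<^sub>R (indicator K x *\<^sub>R h x))"
  proof (rule Bochner_Integration.integrable_bound)
    show "integrable lebesgue (\<lambda>x. B * norm (indicator K x *\<^sub>R h x))"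
      using integrable_norm[OF i] by (rule integrable_mult_right)
    show "(\<lambda>x. v x *\<^sub>R (indicator K x *\<^sub>R h x)) \<in> borel_measurable lebesgue"
      using v(1) by (intro borel_measurable_scaleR measurable_completion borel_measurable_integrable[OF i]) simp
    have "norm (v x *\<^sub>R (indicator K x *\<^sub>R h x)) \<le> norm (B * norm (indicator K x *\<^sub>R h x))" for x
    proof -
      have "\<bar>v x\<bar> \<le> \<bar>B\<bar>" using v(2)[of x] by linarith
      then show ?thesis by (auto simp: indicator_def abs_mult intro!: mult_right_mono)
    qed
    then show "AE x in lebesgue. norm (v x *\<^sub>R (indicator K x *\<^sub>R h x))
        \<le> norm (B * norm (indicator K x *\<^sub>R h x))" by simp
  qed
  also have "(\<lambda>x. v x *\<^sub>R (indicator K x *\<^sub>R h x)) = (\<lambda>x. indicator \<Omega> x *\<^sub>R (v x *\<^sub>R h x))"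
    using K v(3) by (auto simp: indicator_def fun_eq_iff)
  finally show ?thesis
    using \<Omega> by (subst integrable_restrict_space) auto
qed

lemma tendsto_integral_scaleR:
  fixes h :: "'a::euclidean_space \<Rightarrow> 'b::euclidean_space" and v :: "nat \<Rightarrow> 'a \<Rightarrow> real"
  assumes \<Omega>: "\<Omega> \<in> sets lebesgue" and K: "K \<subseteq> \<Omega>" "compact K" and h: "h absolutely_integrable_on K"
    and v: "\<And>k. v k \<in> borel_measurable borel" "\<And>k x. \<bar>v k x\<bar> \<le> B" "\<And>k x. x \<notin> K \<Longrightarrow> v k x = 0"
    and w: "w \<in> borel_measurable borel" "\<And>x. \<bar>w x\<bar> \<le> B" "\<And>x. x \<notin> K \<Longrightarrow> w x = 0"
    and lim: "\<And>x. (\<lambda>k. v k x) \<longlonglongrightarrow> w x"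
  shows "(\<lambda>k. LINT x|lebesgue_on \<Omega>. v k x *\<^sub>R h x) \<longlonglongrightarrow> (LINT x|lebesgue_on \<Omega>. w x *\<^sub>R h x)"
proof (rule integral_dominated_convergence)
  have B: "0 \<le> B" using w(2) abs_ge_zero order_trans by blast
  have m: "(\<lambda>x. B * indicator K x) \<in> borel_measurable borel"
    using K(2) by (intro borel_measurable_times borel_measurable_const borel_measurable_indicator)
      (simp add: borel_compact)
  have "integrable (lebesgue_on \<Omega>) (\<lambda>x. (B * indicator K x) *\<^sub>R h x)"
    by (rule integrable_lebesgue_on_scaleR[OF \<Omega> K(1) h m, where B=B])
      (use B in \<open>auto simp: indicator_def\<close>)
  from integrable_norm[OF this]
  show "integrable (lebesgue_on \<Omega>) (\<lambda>x. norm ((B * indicator K x) *\<^sub>R h x))" .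
  show "(\<lambda>x. w x *\<^sub>R h x) \<in> borel_measurable (lebesgue_on \<Omega>)"
    by (rule borel_measurable_integrable[OF integrable_lebesgue_on_scaleR[OF \<Omega> K(1) h w]])
  show "(\<lambda>x. v k x *\<^sub>R h x) \<in> borel_measurable (lebesgue_on \<Omega>)" for k
    by (rule borel_measurable_integrable[OF integrable_lebesgue_on_scaleR[OF \<Omega> K(1) h v]])
  show "AE x in lebesgue_on \<Omega>. (\<lambda>k. v k x *\<^sub>R h x) \<longlonglongrightarrow> w x *\<^sub>R h x"
    by (intro AE_I2 tendsto_intros lim)
  show "AE x in lebesgue_on \<Omega>. norm (v k x *\<^sub>R h x) \<le> norm ((B * indicator K x) *\<^sub>R h x)" for k
  proof (intro AE_I2)
    fix x
    show "norm (v k x *\<^sub>R h x) \<le> norm ((B * indicator K x) *\<^sub>R h x)"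
      using v(2)[of k x] v(3)[of x k] B
      by (cases "x \<in> K") (auto simp: abs_mult intro!: mult_right_mono)
  qed
qed

lemma compact_neighbourhood:
  fixes K :: "'a::euclidean_space set"
  assumes "open \<Omega>" "compact K" "K \<subseteq> \<Omega>"
  obtains d K' where "d > 0" "compact K'" "K \<subseteq> K'" "K' \<subseteq> \<Omega>"
    "\<And>x y. y \<in> K \<Longrightarrow> dist y x \<le> d \<Longrightarrow> x \<in> K'"
proof -
  obtain e where e: "e > 0" "(\<Union>x\<in>K. ball x e) \<subseteq> \<Omega>"
    using compact_subset_open_imp_ball_epsilon_subset[OF assms(2,1,3)] by blast
  let ?K' = "{x + y |x y. x \<in> K \<and> y \<in> cball 0 (e/2)}"
  show ?thesis
  proof
    show "e / 2 > 0" using e by simp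
    show "compact ?K'" by (rule compact_sums[OF assms(2) compact_cball])
    show "K \<subseteq> ?K'" using e by (force intro: exI[of _ 0])
    show "?K' \<subseteq> \<Omega>"
    proof
      fix z assume "z \<in> ?K'"
      then obtain x y where "z = x + y" "x \<in> K" "norm y \<le> e / 2" by auto
      then have "z \<in> ball x e" using e by (simp add: dist_norm)
      then show "z \<in> \<Omega>" using e \<open>x \<in> K\<close> by blast
    qed
    show "x \<in> ?K'" if "y \<in> K" "dist y x \<le> e / 2" for x y
    proof -
      have "x = y + (x - y)" "x - y \<in> cball 0 (e / 2)"
        using that by (simp_all add: dist_norm norm_minus_commute)
      then show ?thesis using that(1) by blast
    qed
  qed
qed

text \<open>Inner regularity of Lebesgue measure; boundedness turns the approximating closed sets into compact ones.\<close>

lemma compact_inner_approximation_null: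
  fixes S :: "'a::euclidean_space set"
  assumes "S \<in> sets lebesgue" "bounded S" "\<And>T. compact T \<Longrightarrow> T \<subseteq> S \<Longrightarrow> emeasure lebesgue T = 0"
  shows "S \<in> null_sets lebesgue"
proof -
  have le: "emeasure lebesgue S \<le> ennreal e" if "e > 0" for e
  proof -
    obtain T where T: "closed T" "T \<subseteq> S" "S - T \<in> lmeasurable" "emeasure lebesgue (S - T) < ennreal e"
      using sets_lebesgue_inner_closed[OF assms(1) \<open>e > 0\<close>] by metis
    have "compact T" using T assms(2) bounded_subset compact_eq_bounded_closed by blast
    have "emeasure lebesgue S \<le> emeasure lebesgue T + emeasure lebesgue (S - T)"
      using T emeasure_subadditive[of T lebesgue "S - T"] by (simp add: Un_absorb1 fmeasurableD)
    then show ?thesis using assms(3)[OF \<open>compact T\<close> T(2)] T(4) by (simp add: order.strict_implies_order order_le_less_trans)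
  qed
  have "emeasure lebesgue S \<le> 0" by (rule ennreal_le_epsilon) (simp add: le)
  then have "emeasure lebesgue S = 0" by simp
  then show ?thesis using assms(1) by (rule null_setsI)
qed

text \<open>The fundamental lemma of the calculus of variations. The class of functions against which \<open>h\<close> integrates to
0 grows from test functions to continuous functions by mollification, and to indicators of compact
sets by continuous cutoffs, each time by dominated convergence. A set where a component of \<open>h\<close> has a strict sign
then has no compact subset of positive measure.\<close>

lemma vanishing_on_test_functions_imp_AE_0:
  fixes h :: "'a::euclidean_space \<Rightarrow> 'b::euclidean_space"
  assumes \<Omega>: "open \<Omega>" "bounded \<Omega>" and h_meas: "h \<in> borel_measurable (lebesgue_on \<Omega>)"
    and h: "\<And>K. compact K \<Longrightarrow> K \<subseteq> \<Omega> \<Longrightarrow> h absolutely_integrable_on K"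
    and test: "\<And>\<phi>. test_fun \<Omega> \<phi> \<Longrightarrow> (LINT x|lebesgue_on \<Omega>. \<phi> x *\<^sub>R h x) = 0"
  shows "AE x in lebesgue_on \<Omega>. h x = 0"
proof -
  have \<Omega>': "\<Omega> \<in> sets lebesgue" using \<Omega>(1) by simp
  have continuous: "(LINT x|lebesgue_on \<Omega>. v x *\<^sub>R h x) = 0"
    if v: "continuous_on UNIV v" "compact K" "K \<subseteq> \<Omega>" "\<And>x. x \<notin> K \<Longrightarrow> v x = 0" "\<And>x. \<bar>v x\<bar> \<le> B"
    for v :: "'a \<Rightarrow> real" and K B
  proof -
    obtain d K' where d: "d > 0" and K': "compact K'" "K \<subseteq> K'" "K' \<subseteq> \<Omega>"
        and near: "\<And>x y. y \<in> K \<Longrightarrow> dist y x \<le> d \<Longrightarrow> x \<in> K'"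
      using compact_neighbourhood[OF \<Omega>(1) v(2,3)] by metis
    define e where "e k = d / real (Suc k)" for k
    have e: "0 < e k" "e k \<le> d" for k using d by (auto simp: e_def field_simps)
    have "\<exists>\<eta>::'a \<Rightarrow> real. mollifier (e k) \<eta>" for k
      using mollifier_exists[OF e(1)[of k]] by blast
    then obtain \<eta> :: "nat \<Rightarrow> 'a \<Rightarrow> real" where \<eta>: "\<And>k. mollifier (e k) (\<eta> k)" by metis
    have t: "test_fun \<Omega> (mollify (\<eta> k) v)" for k
      by (rule test_fun_mollify[OF \<eta> v(1,4) K'(1,3)]) (use near e order_trans in blast)+
    have lim: "(\<lambda>k. mollify (\<eta> k) v x) \<longlonglongrightarrow> v x" for x
    proof (rule LIMSEQ_I)
      fix r :: real assume r: "0 < r"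
      have "isCont v x" using v(1) by (simp add: continuous_on_eq_continuous_at)
      then obtain s where s: "s > 0" "\<And>y. dist y x < s \<Longrightarrow> dist (v y) (v x) < r / 2"
        using r unfolding continuous_at_eps_delta by (metis half_gt_zero)
      have "e \<longlonglongrightarrow> 0" unfolding e_def by (rule LIMSEQ_Suc[OF lim_const_over_n])
      then have "\<forall>\<^sub>F k in sequentially. e k < s" using s(1) by (rule order_tendstoD)
      then obtain k0 where k0: "\<And>k. k \<ge> k0 \<Longrightarrow> e k < s" by (auto simp: eventually_sequentially)
      have "\<bar>mollify (\<eta> k) v x - v x\<bar> \<le> r / 2" if "k \<ge> k0" for k
      proof (rule mollify_close[OF \<eta>[of k] v(1)])
        fix z :: 'a assume "norm z \<le> e k"
        then show "\<bar>v (x + z) - v x\<bar> \<le> r / 2"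
          using k0[OF that] s(2)[of "x + z"] by (simp add: dist_norm)
      qed
      then show "\<exists>no. \<forall>n\<ge>no. norm (mollify (\<eta> n) v x - v x) < r"
        using r by (intro exI[of _ k0]) fastforce
    qed
    have "(\<lambda>k. LINT x|lebesgue_on \<Omega>. mollify (\<eta> k) v x *\<^sub>R h x) \<longlonglongrightarrow> (LINT x|lebesgue_on \<Omega>. v x *\<^sub>R h x)"
    proof (rule tendsto_integral_scaleR[OF \<Omega>' K'(3,1) h[OF K'(1,3)], where B=B])
      show "mollify (\<eta> k) v \<in> borel_measurable borel" for k
        by (intro borel_measurable_continuous_onI smooth_continuous smooth_mollify[OF \<eta> v(1)])
      show "v \<in> borel_measurable borel" by (intro borel_measurable_continuous_onI v)
      show "\<bar>mollify (\<eta> k) v x\<bar> \<le> B" for k x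
        using mollify_close[OF \<eta>[of k] v(1), of x 0 B] v(5) by simp
      show "mollify (\<eta> k) v x = 0" if "x \<notin> K'" for k x
      proof (rule ccontr)
        assume "mollify (\<eta> k) v x \<noteq> 0"
        with v(4) obtain y where "y \<in> K" "dist y x \<le> e k"
          by (rule mollify_support[OF \<eta> v(1), of K])
        then show False using near[of y x] e(2)[of k] that by simp
      qed
      show "v x = 0" if "x \<notin> K'" for x by (rule v(4)) (use K'(2) that in blast)
    qed (rule v(5) lim)+
    then show ?thesis using test[OF t] by (simp add: LIMSEQ_const_iff)
  qed
  have compact0: "(LINT x|lebesgue_on \<Omega>. indicator C x *\<^sub>R h x) = 0" if C: "compact C" "C \<subseteq> \<Omega>" for C
  proof (cases "C = {}")
    case False
    obtain d K' where d: "d > 0" and K': "compact K'" "C \<subseteq> K'" "K' \<subseteq> \<Omega>"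
        and near: "\<And>x y. y \<in> C \<Longrightarrow> dist y x \<le> d \<Longrightarrow> x \<in> K'"
      using compact_neighbourhood[OF \<Omega>(1) C] by metis
    \<comment> \<open>Cutoffs that decrease to the indicator of \<open>C\<close> and vanish at distance \<open>d\<close> from it.\<close>
    define v where "v k x = max 0 (1 - real (Suc k) / d * infdist x C)" for k x
    have cv: "continuous_on UNIV (v k)" for k unfolding v_def by (intro continuous_intros)
    have bv: "\<bar>v k x\<bar> \<le> 1" for k x
      unfolding v_def using d by (auto simp: infdist_nonneg)
    have sv: "v k x = 0" if "x \<notin> K'" for k x
    proof -
      obtain y where "y \<in> C" "infdist x C = dist x y"
        using infdist_attains_inf[OF compact_imp_closed[OF C(1)] False] by blast
      then have "d < infdist x C" using near[of y x] that by (force simp: dist_commute)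
      then have "1 * 1 \<le> real (Suc k) * (infdist x C / d)"
        using d by (intro mult_mono) auto
      then show ?thesis by (simp add: v_def)
    qed
    have lv: "(\<lambda>k. v k x) \<longlonglongrightarrow> indicator C x" for x
    proof (cases "x \<in> C")
      case True then show ?thesis by (simp add: v_def)
    next
      case F: False
      then have i: "infdist x C > 0"
        using False C compact_imp_closed in_closed_iff_infdist_zero infdist_nonneg by (metis less_eq_real_def)
      obtain k0 where k0: "d / infdist x C < real k0" using reals_Archimedean2 by blast
      have "v k x = 0" if "k \<ge> k0" for k
      proof -
        have "d / infdist x C \<le> real (Suc k)" using k0 that by simp
        then show ?thesis using d i by (simp add: v_def field_simps)
      qed
      then have "\<forall>\<^sub>F k in sequentially. v k x = indicator C x"
        using F unfolding eventually_sequentially by (intro exI[of _ k0]) simp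
      then show ?thesis by (rule tendsto_eventually)
    qed
    have "(\<lambda>k. LINT x|lebesgue_on \<Omega>. v k x *\<^sub>R h x) \<longlonglongrightarrow> (LINT x|lebesgue_on \<Omega>. indicator C x *\<^sub>R h x)"
    proof (rule tendsto_integral_scaleR[OF \<Omega>' K'(3,1) h[OF K'(1,3)], where B=1])
      show "v k \<in> borel_measurable borel" for k by (intro borel_measurable_continuous_onI cv)
      show "(indicator C :: 'a \<Rightarrow> real) \<in> borel_measurable borel"
        by (intro borel_measurable_indicator borel_compact C)
      show "(indicator C x :: real) = 0" if "x \<notin> K'" for x using that K'(2) by (auto simp: indicator_def)
    qed (use bv sv lv in \<open>auto simp: indicator_def\<close>)
    then show ?thesis using continuous[OF cv K'(1,3) sv bv] by (simp add: LIMSEQ_const_iff)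
  qed simp
  have half: "AE x in lebesgue_on \<Omega>. h x \<bullet> c \<le> 0" for c
  proof -
    let ?S = "{x\<in>\<Omega>. h x \<bullet> c > 0}"
    have "{x \<in> space (lebesgue_on \<Omega>). h x \<bullet> c > 0} \<in> sets (lebesgue_on \<Omega>)"
      using h_meas by measurable
    then have S: "?S \<in> sets lebesgue"
      using \<Omega>' by (simp add: sets_restrict_space_iff)
    have "?S \<in> null_sets lebesgue"
    proof (rule compact_inner_approximation_null[OF S])
      show "bounded ?S" using \<Omega>(2) by (rule bounded_subset) auto
      fix T assume T: "compact T" "T \<subseteq> ?S"
      then have T\<Omega>: "T \<subseteq> \<Omega>" by blast
      have i: "integrable (lebesgue_on \<Omega>) (\<lambda>x. indicator T x *\<^sub>R h x)"
        by (rule integrable_lebesgue_on_scaleR[OF \<Omega>' T\<Omega> h[OF T(1) T\<Omega>]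
              borel_measurable_indicator[OF borel_compact[OF T(1)]], where B=1])
          (auto simp: indicator_def)
      have int0: "(LINT x|lebesgue_on \<Omega>. (indicator T x *\<^sub>R h x) \<bullet> c) = 0"
        by (subst integral_inner_left[OF i]) (simp add: compact0[OF T(1) T\<Omega>])
      have ic: "integrable (lebesgue_on \<Omega>) (\<lambda>x. (indicator T x *\<^sub>R h x) \<bullet> c)"
        by (rule integrable_inner_left) (rule i)
      have nonneg: "AE x in lebesgue_on \<Omega>. 0 \<le> (indicator T x *\<^sub>R h x) \<bullet> c"
        using T(2) by (intro AE_I2) (auto simp: indicator_def less_imp_le)
      have "AE x in lebesgue_on \<Omega>. (indicator T x *\<^sub>R h x) \<bullet> c = 0"
        by (rule iffD1[OF integral_nonneg_eq_0_iff_AE[OF ic nonneg] int0])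
      then have "AE x in lebesgue. x \<in> \<Omega> \<longrightarrow> (indicator T x *\<^sub>R h x) \<bullet> c = 0"
        using \<Omega>' by (subst (asm) AE_restrict_space_iff) auto
      then have "AE x in lebesgue. x \<notin> T"
      proof eventually_elim
        case (elim x)
        then show ?case using T(2) by (auto simp: indicator_def)
      qed
      moreover have "T \<in> sets lebesgue" using borel_compact[OF T(1)] by simp
      ultimately have "T \<in> null_sets lebesgue" by (simp add: AE_iff_null_sets)
      then show "emeasure lebesgue T = 0" by (rule null_setsD1)
    qed
    then have "AE x in lebesgue. x \<notin> ?S" by (rule AE_not_in)
    then have "AE x in lebesgue. x \<in> \<Omega> \<longrightarrow> h x \<bullet> c \<le> 0" by eventually_elim auto
    then show ?thesis using \<Omega>' by (subst AE_restrict_space_iff) auto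
  qed
  have "AE x in lebesgue_on \<Omega>. \<forall>b\<in>Basis. h x \<bullet> b \<le> 0 \<and> h x \<bullet> (- b) \<le> 0"
    by (intro AE_finite_allI AE_conjI half finite_Basis)
  then show ?thesis
  proof eventually_elim
    case (elim x)
    show ?case
    proof (rule euclidean_eqI)
      fix b :: 'b assume "b \<in> Basis"
      then have "h x \<bullet> b \<le> 0 \<and> h x \<bullet> (- b) \<le> 0" using elim by blast
      then show "h x \<bullet> b = 0 \<bullet> b" by simp
    qed
  qed
qed

lemma weak_gradient_unique:
  assumes \<Omega>: "open \<Omega>" "bounded \<Omega>"
    and g: "has_weak_gradient \<Omega> u g" "g \<in> borel_measurable (lebesgue_on \<Omega>)"
    and g': "has_weak_gradient \<Omega> u g'" "g' \<in> borel_measurable (lebesgue_on \<Omega>)"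
  shows "AE x in lebesgue_on \<Omega>. g x = g' x"
proof -
  have \<Omega>': "\<Omega> \<in> sets lebesgue" using \<Omega>(1) by simp
  have "AE x in lebesgue_on \<Omega>. g x - g' x = 0"
  proof (rule vanishing_on_test_functions_imp_AE_0[OF \<Omega>])
    show "(\<lambda>x. g x - g' x) \<in> borel_measurable (lebesgue_on \<Omega>)" using g(2) g'(2) by simp
    show "(\<lambda>x. g x - g' x) absolutely_integrable_on K" if "compact K" "K \<subseteq> \<Omega>" for K
      using g(1) g'(1) that by (intro set_integral_diff) (auto simp: has_weak_gradient_def)
    fix \<phi> assume t: "test_fun \<Omega> \<phi>"
    obtain K where K: "smooth \<phi>" "compact K" "K \<subseteq> \<Omega>" "\<And>x. x \<notin> K \<Longrightarrow> \<phi> x = 0"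
      using test_funE[OF t] by metis
    obtain B where B: "\<And>x. \<bar>\<phi> x\<bar> \<le> B"
    proof -
      have "bounded (\<phi> ` K)"
        by (intro compact_imp_bounded compact_continuous_image smooth_continuous K)
      then obtain B where "\<And>x. x \<in> K \<Longrightarrow> \<bar>\<phi> x\<bar> \<le> B" by (auto simp: bounded_iff)
      then have "\<bar>\<phi> x\<bar> \<le> max 0 B" for x using K(4)[of x] by (cases "x \<in> K") force+
      then show ?thesis using that by blast
    qed
    have m: "\<phi> \<in> borel_measurable borel"
      by (intro borel_measurable_continuous_onI smooth_continuous K)
    have "integrable (lebesgue_on \<Omega>) (\<lambda>x. \<phi> x *\<^sub>R g x)" "integrable (lebesgue_on \<Omega>) (\<lambda>x. \<phi> x *\<^sub>R g' x)"
      using g(1) g'(1) K by (auto simp: has_weak_gradient_def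
          intro!: integrable_lebesgue_on_scaleR[OF \<Omega>' K(3) _ m B])
    moreover have "(LINT x|lebesgue_on \<Omega>. \<phi> x *\<^sub>R g x) = (LINT x|lebesgue_on \<Omega>. \<phi> x *\<^sub>R g' x)"
      using g(1) g'(1) t unfolding has_weak_gradient_def by (metis neg_equal_iff_equal)
    ultimately show "(LINT x|lebesgue_on \<Omega>. \<phi> x *\<^sub>R (g x - g' x)) = 0"
      by (simp add: scaleR_diff_right)
  qed
  then show ?thesis by simp
qed

section \<open>The inradius and the mollified cone\<close>

definition inradius :: "'a::euclidean_space set \<Rightarrow> real" where
  "inradius \<Omega> = (SUP x\<in>\<Omega>. infdist x (- \<Omega>))"

lemma bounded_imp_Compl_nonempty:
  fixes \<Omega> :: "'a::euclidean_space set"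
  shows "bounded \<Omega> \<Longrightarrow> - \<Omega> \<noteq> {}"
  by (metis Compl_empty_eq double_complement not_bounded_UNIV)

lemma nearest_exterior_point:
  fixes \<Omega> :: "'a::euclidean_space set"
  assumes "open \<Omega>" "bounded \<Omega>"
  obtains z where "z \<notin> \<Omega>" "dist x z = infdist x (- \<Omega>)" "ball x (dist x z) \<subseteq> \<Omega>"
proof -
  have c: "closed (- \<Omega>)" using assms(1) by auto
  obtain z where z: "z \<in> - \<Omega>" "infdist x (- \<Omega>) = dist x z"
    using infdist_attains_inf[OF c bounded_imp_Compl_nonempty[OF assms(2)]] by metis
  have "ball x (dist x z) \<subseteq> \<Omega>"
  proof
    fix y assume "y \<in> ball x (dist x z)"
    then show "y \<in> \<Omega>" using infdist_le[of y "- \<Omega>" x] z(2) by force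
  qed
  then show ?thesis using that z by simp
qed

lemma infdist_le_inradius:
  fixes \<Omega> :: "'a::euclidean_space set"
  assumes "bounded \<Omega>" "x \<in> \<Omega>"
  shows "infdist x (- \<Omega>) \<le> inradius \<Omega>"
proof -
  obtain z where z: "z \<in> - \<Omega>" using bounded_imp_Compl_nonempty[OF assms(1)] by blast
  obtain B where B: "\<And>y. y \<in> \<Omega> \<Longrightarrow> norm y \<le> B" using assms(1) by (auto simp: bounded_iff)
  have "infdist y (- \<Omega>) \<le> B + norm z" if "y \<in> \<Omega>" for y
    using infdist_le[OF z, of y] B[OF that] norm_triangle_ineq4[of y z] by (simp add: dist_norm)
  then have "bdd_above ((\<lambda>x. infdist x (- \<Omega>)) ` \<Omega>)" by (auto intro!: bdd_aboveI)
  then show ?thesis unfolding inradius_def by (rule cSUP_upper[OF assms(2)])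
qed

lemma inradius_pos:
  fixes \<Omega> :: "'a::euclidean_space set"
  assumes "open \<Omega>" "bounded \<Omega>" "\<Omega> \<noteq> {}"
  shows "inradius \<Omega> > 0"
proof -
  obtain x where x: "x \<in> \<Omega>" using assms(3) by blast
  obtain z where "z \<notin> \<Omega>" "dist x z = infdist x (- \<Omega>)" using nearest_exterior_point[OF assms(1,2)] by metis
  then have "0 < infdist x (- \<Omega>)" using x by (metis zero_less_dist_iff)
  then show ?thesis using infdist_le_inradius[OF assms(2) x] by simp
qed

text \<open>The difference quotient in the direction of the gradient itself tends to its squared norm.\<close>

lemma GDERIV_norm_le:
  fixes f :: "'a::euclidean_space \<Rightarrow> real"
  assumes f: "GDERIV f x :> g" and lip: "\<And>y. \<bar>f y - f x\<bar> \<le> C * norm (y - x)"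
  shows "norm g \<le> C"
proof -
  have "((\<lambda>t. x + t *\<^sub>R g) has_derivative (\<lambda>t. t *\<^sub>R g)) (at 0)" by (auto intro!: derivative_eq_intros)
  from has_derivative_compose[OF this, of f "\<lambda>h. h \<bullet> g"] f
  have "((\<lambda>t. f (x + t *\<^sub>R g)) has_real_derivative (g \<bullet> g)) (at 0)"
    by (simp add: gderiv_def has_field_derivative_def mult_commute_abs)
  then have "((\<lambda>t. (f (x + t *\<^sub>R g) - f x) / t) \<longlongrightarrow> g \<bullet> g) (at 0)"
    by (simp add: has_field_derivative_iff)
  moreover have "\<forall>\<^sub>F t in at 0. (f (x + t *\<^sub>R g) - f x) / t \<le> C * norm g"
  proof -
    have "(f (x + t *\<^sub>R g) - f x) / t \<le> C * norm g" if "t \<noteq> 0" for t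
    proof -
      have "(f (x + t *\<^sub>R g) - f x) / t \<le> \<bar>f (x + t *\<^sub>R g) - f x\<bar> / \<bar>t\<bar>"
        by (metis abs_divide abs_ge_self)
      also have "\<dots> \<le> C * norm g"
        using lip[of "x + t *\<^sub>R g"] that by (simp add: field_simps)
      finally show ?thesis .
    qed
    then show ?thesis by (auto simp: eventually_at_filter)
  qed
  ultimately have "g \<bullet> g \<le> C * norm g" by (rule tendsto_upperbound) simp
  then have le: "norm g * norm g \<le> C * norm g" by (simp add: dot_square_norm power2_eq_square)
  show ?thesis
  proof (cases "g = 0")
    case True
    obtain b :: 'a where "b \<in> Basis" using nonempty_Basis by blast
    then have "0 \<le> C" using lip[of "x + b"] by simp
    then show ?thesis using True by simp
  qed (use le in simp)
qed

text \<open>Mollifying the cone keeps its Lipschitz constant. The cone is lowered by twice the mollification radius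
so that the mollified support stays inside the ball, and its tip is still above \<open>r\<close> nearby.\<close>

lemma smooth_cone_exists:
  fixes \<Omega> :: "'a::euclidean_space set"
  assumes \<Omega>: "open \<Omega>" "bounded \<Omega>" "\<Omega> \<noteq> {}" and r: "r < inradius \<Omega>"
  obtains \<phi> x0 s where "test_fun \<Omega> \<phi>" "\<And>x. norm (gradient \<phi> x) \<le> 1"
    "s > 0" "ball x0 s \<subseteq> \<Omega>" "\<And>x. x \<in> ball x0 s \<Longrightarrow> r \<le> \<phi> x"
proof -
  obtain x0 where x0: "x0 \<in> \<Omega>" "r < infdist x0 (- \<Omega>)"
    using less_cSUP_iff r \<Omega>(3) unfolding inradius_def
    by (metis (no_types, lifting) cSUP_least not_le)
  obtain z where z: "z \<notin> \<Omega>" "dist x0 z = infdist x0 (- \<Omega>)" "ball x0 (dist x0 z) \<subseteq> \<Omega>"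
    using nearest_exterior_point[OF \<Omega>(1,2)] by metis
  define R where "R = dist x0 z"
  have R: "0 < R" "r < R" using x0 z zero_less_dist_iff[of x0 z] by (auto simp: R_def simp del: zero_less_dist_iff)
  define \<epsilon> where "\<epsilon> = (R - max r 0) / 4"
  have "4 * \<epsilon> = R - max r 0" by (simp add: \<epsilon>_def)
  then have \<epsilon>: "\<epsilon> > 0" "r \<le> R - 4 * \<epsilon>" "4 * \<epsilon> \<le> R" using R by linarith+
  \<comment> \<open>The radius loses \<open>2 \<epsilon>\<close> here, the height another \<open>\<epsilon>\<close> on \<open>ball x0 \<epsilon>\<close> and another \<open>\<epsilon>\<close> by mollification.\<close>
  define w where "w y = max 0 (R - 2 * \<epsilon> - norm (y - x0))" for y
  have cw: "continuous_on UNIV w" unfolding w_def by (intro continuous_intros)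
  have lw: "\<bar>w x - w y\<bar> \<le> 1 * norm (x - y)" for x y
    using norm_triangle_ineq3[of "x - x0" "y - x0"] unfolding w_def by simp
  obtain \<eta> :: "'a \<Rightarrow> real" where \<eta>: "mollifier \<epsilon> \<eta>"
    using mollifier_exists[OF \<epsilon>(1)] by blast
  define \<phi> where "\<phi> = mollify \<eta> w"
  have \<phi>: "smooth \<phi>" unfolding \<phi>_def by (rule smooth_mollify[OF \<eta> cw])
  show ?thesis
  proof
    show "test_fun \<Omega> \<phi>" unfolding \<phi>_def
    proof (rule test_fun_mollify[OF \<eta> cw, where K="cball x0 (R - 2 * \<epsilon>)" and K'="cball x0 (R - \<epsilon>)"])
      show "w y = 0" if "y \<notin> cball x0 (R - 2 * \<epsilon>)" for y
        using that by (simp add: w_def dist_norm norm_minus_commute)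
      show "cball x0 (R - \<epsilon>) \<subseteq> \<Omega>" using z(3) \<epsilon> by (auto simp: R_def)
      show "x \<in> cball x0 (R - \<epsilon>)" if "y \<in> cball x0 (R - 2 * \<epsilon>)" "dist y x \<le> \<epsilon>" for x y
        using that dist_triangle[of x0 x y] by simp
    qed simp
    show "norm (gradient \<phi> x) \<le> 1" for x
      by (rule GDERIV_norm_le[OF smooth_gradient[OF \<phi>]])
        (unfold \<phi>_def, rule mollify_lipschitz[OF \<eta> cw lw])
    show "\<epsilon> > 0" by fact
    show "ball x0 \<epsilon> \<subseteq> \<Omega>" using z(3) \<epsilon> by (auto simp: R_def)
    fix x assume x: "x \<in> ball x0 \<epsilon>"
    have "\<bar>\<phi> x - (R - 3 * \<epsilon>)\<bar> \<le> \<epsilon>" unfolding \<phi>_def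
    proof (rule mollify_close[OF \<eta> cw])
      fix y :: 'a assume y: "norm y \<le> \<epsilon>"
      have "norm (x + y - x0) \<le> 2 * \<epsilon>"
        using x y norm_triangle_ineq[of "x - x0" y] by (simp add: dist_norm norm_minus_commute algebra_simps)
      moreover have "0 \<le> norm (x + y - x0)" by simp
      ultimately show "\<bar>w (x + y) - (R - 3 * \<epsilon>)\<bar> \<le> \<epsilon>"
        using \<epsilon> unfolding w_def by linarith
    qed
    then show "r \<le> \<phi> x" using \<epsilon> by linarith
  qed
qed

section \<open>The first infinity-eigenvalue\<close>

lemma Linf_norm_leI:
  assumes "f \<in> borel_measurable M" "AE x in M. norm (f x) \<le> C" "emeasure M (space M) \<noteq> 0"
  shows "f \<in> Linf_space M" "Linf_norm M f \<le> C"
proof -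
  have m: "(\<lambda>x. ereal (norm (f x))) \<in> borel_measurable M" using assms(1) by simp
  have le: "esssup M (\<lambda>x. ereal (norm (f x))) \<le> ereal C"
    by (rule esssup_I[OF m]) (use assms(2) in simp)
  then show "f \<in> Linf_space M" using assms(1) by (auto simp: Linf_space_def)
  have "0 = esssup M (\<lambda>x. 0::ereal)" using esssup_const[OF assms(3)] by metis
  also have "\<dots> \<le> esssup M (\<lambda>x. ereal (norm (f x)))" by (rule esssup_mono) auto
  finally show "Linf_norm M f \<le> C"
    using le unfolding Linf_norm_def by (cases "esssup M (\<lambda>x. ereal (norm (f x)))") auto
qed

lemma Linf_norm_AE:
  assumes "f \<in> Linf_space M" "emeasure M (space M) \<noteq> 0"
  shows "AE x in M. norm (f x) \<le> Linf_norm M f" "0 \<le> Linf_norm M f"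
proof -
  have "0 = esssup M (\<lambda>x. 0::ereal)" using esssup_const[OF assms(2)] by metis
  also have "\<dots> \<le> esssup M (\<lambda>x. ereal (norm (f x)))" by (rule esssup_mono) auto
  finally obtain c where c: "esssup M (\<lambda>x. ereal (norm (f x))) = ereal c" "0 \<le> c"
    using assms(1) by (cases "esssup M (\<lambda>x. ereal (norm (f x)))") (auto simp: Linf_space_def)
  then show "0 \<le> Linf_norm M f" by (simp add: Linf_norm_def)
  show "AE x in M. norm (f x) \<le> Linf_norm M f"
    using esssup_AE[of "\<lambda>x. ereal (norm (f x))" M] c by (simp add: Linf_norm_def)
qed

text \<open>Near the segment, the gradient of the mollification at \<open>s\<close> is the integral of the weak gradient against the
probability density \<open>\<eta> (y - s)\<close>, hence bounded by \<open>M\<close>. The mean value inequality holds for the mollification,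
which approximates \<open>v\<close> at both end points.\<close>

lemma weak_gradient_segment_lipschitz:
  fixes \<Omega> :: "'a::euclidean_space set"
  assumes \<Omega>: "open \<Omega>" and v: "continuous_on UNIV v" "\<And>x. x \<notin> \<Omega> \<Longrightarrow> v x = 0"
    and u: "u \<in> borel_measurable (lebesgue_on \<Omega>)" and uv: "AE x in lebesgue_on \<Omega>. u x = v x"
    and g: "has_weak_gradient \<Omega> u g" "AE x in lebesgue_on \<Omega>. norm (g x) \<le> M"
    and M: "0 \<le> M" and seg: "closed_segment x y \<subseteq> \<Omega>"
  shows "\<bar>v x - v y\<bar> \<le> M * norm (x - y)"
proof (rule field_le_epsilon)
  fix e :: real assume e: "0 < e"
  have \<Omega>': "\<Omega> \<in> sets lebesgue" using \<Omega> by simp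
  obtain d K' where d: "d > 0" and K': "compact K'" "K' \<subseteq> \<Omega>"
      and near: "\<And>a b. b \<in> closed_segment x y \<Longrightarrow> dist b a \<le> d \<Longrightarrow> a \<in> K'"
    using compact_neighbourhood[OF \<Omega> compact_segment seg] by metis
  have "isCont v x" "isCont v y" using v(1) by (simp_all add: continuous_on_eq_continuous_at)
  then obtain d1 d2 where d1: "d1 > 0" "\<And>z. dist z x < d1 \<Longrightarrow> dist (v z) (v x) < e / 2"
    and d2: "d2 > 0" "\<And>z. dist z y < d2 \<Longrightarrow> dist (v z) (v y) < e / 2"
    using e unfolding continuous_at_eps_delta by (metis half_gt_zero)
  define \<delta> where "\<delta> = min d (min d1 d2) / 2"
  have \<delta>: "\<delta> > 0" "\<delta> \<le> d" "\<delta> < d1" "\<delta> < d2" using d d1 d2 by (auto simp: \<delta>_def)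
  obtain \<eta> :: "'a \<Rightarrow> real" where \<eta>: "mollifier \<delta> \<eta>"
    using mollifier_exists[OF \<delta>(1)] by blast
  have sm: "smooth \<eta>" and nn: "\<And>z. 0 \<le> \<eta> z" and su: "\<And>z. z \<notin> cball 0 \<delta> \<Longrightarrow> \<eta> z = 0"
    and it: "integrable lborel \<eta>" "integral\<^sup>L lborel \<eta> = 1"
    using \<eta> by (auto simp: mollifier_def)
  define U where "U = mollify \<eta> v"
  define D where "D s = - (LBINT y. v y *\<^sub>R gradient \<eta> (y - s))" for s
  have U: "GDERIV U s :> D s" for s
    unfolding U_def D_def mollify_def
    by (rule GDERIV_correlation[OF v(1) smooth_gradient[OF sm] continuous_on_gradient[OF sm] su])
  have D: "norm (D s) \<le> M" if s: "s \<in> closed_segment x y" for s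
  proof -
    let ?\<phi> = "\<lambda>y. \<eta> (y - s)"
    have sub: "cball s \<delta> \<subseteq> \<Omega>" using near[OF s] K'(2) \<delta>(2) by auto
    have \<phi>0: "?\<phi> z = 0" if "z \<notin> cball s \<delta>" for z
      using su[of "z - s"] that by (simp add: dist_norm norm_minus_commute)
    have s\<phi>: "smooth ?\<phi>" using sm Ck_fun_translate by blast
    have "closure {z. ?\<phi> z \<noteq> 0} \<subseteq> cball s \<delta>" by (intro closure_minimal closed_cball) (use \<phi>0 in blast)
    then have t: "test_fun \<Omega> ?\<phi>"
      using s\<phi> sub bounded_subset[OF bounded_cball] by (auto simp: test_fun_def compact_eq_bounded_closed)
    have grad: "gradient ?\<phi> z = gradient \<eta> (z - s)" for z
    proof (rule GDERIV_unique[OF smooth_gradient[OF s\<phi>]])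
      show "GDERIV ?\<phi> z :> gradient \<eta> (z - s)"
        unfolding gderiv_def
        by (rule has_derivative_compose[of "\<lambda>z. z - s" "\<lambda>h. h" z UNIV \<eta>, simplified])
          (use smooth_gradient[OF sm, of "z - s"] in \<open>auto simp: gderiv_def intro!: derivative_eq_intros\<close>)
    qed
    have cg: "continuous_on UNIV (gradient ?\<phi>)" by (rule continuous_on_gradient[OF s\<phi>])
    have c\<phi>: "continuous_on UNIV ?\<phi>" by (rule smooth_continuous[OF s\<phi>])
    have "(LBINT z. v z *\<^sub>R gradient ?\<phi> z) = (LINT z|lebesgue_on \<Omega>. v z *\<^sub>R gradient ?\<phi> z)"
      by (rule lebesgue_on_integral_eq(1)[symmetric])
        (auto intro!: \<Omega>' v borel_measurable_continuous_onI continuous_intros cg)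
    also have "\<dots> = (LINT z|lebesgue_on \<Omega>. u z *\<^sub>R gradient ?\<phi> z)"
    proof (rule integral_cong_AE)
      have "gradient ?\<phi> \<in> borel_measurable (lebesgue_on \<Omega>)"
        by (intro continuous_imp_measurable_on_sets_lebesgue \<Omega>' continuous_on_subset[OF cg]) simp
      moreover have "v \<in> borel_measurable (lebesgue_on \<Omega>)"
        by (intro continuous_imp_measurable_on_sets_lebesgue \<Omega>' continuous_on_subset[OF v(1)]) simp
      ultimately show "(\<lambda>z. v z *\<^sub>R gradient ?\<phi> z) \<in> borel_measurable (lebesgue_on \<Omega>)"
        "(\<lambda>z. u z *\<^sub>R gradient ?\<phi> z) \<in> borel_measurable (lebesgue_on \<Omega>)"
        using u by (auto intro: borel_measurable_scaleR)
      show "AE z in lebesgue_on \<Omega>. v z *\<^sub>R gradient ?\<phi> z = u z *\<^sub>R gradient ?\<phi> z"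
        using uv by (rule AE_mp) (auto intro!: AE_I2)
    qed
    also have "\<dots> = - (LINT z|lebesgue_on \<Omega>. ?\<phi> z *\<^sub>R g z)"
      using g(1) t unfolding has_weak_gradient_def by blast
    finally have "D s = (LINT z|lebesgue_on \<Omega>. ?\<phi> z *\<^sub>R g z)" by (simp add: D_def grad)
    moreover have "norm (LINT z|lebesgue_on \<Omega>. ?\<phi> z *\<^sub>R g z) \<le> (LINT z|lebesgue_on \<Omega>. M * ?\<phi> z)"
    proof (rule order_trans[OF integral_norm_bound], rule integral_mono_AE')
      have i: "integrable lborel ?\<phi>" by (rule compact_support_integrable[OF c\<phi> compact_cball[of s \<delta>] \<phi>0])
      have z: "M * ?\<phi> z = 0" if "z \<notin> \<Omega>" for z using \<phi>0[of z] subsetD[OF sub, of z] that by auto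
      show "integrable (lebesgue_on \<Omega>) (\<lambda>z. M * ?\<phi> z)"
        by (subst lebesgue_on_integral_eq(2)[OF \<Omega>' _ z])
          (auto intro!: i borel_measurable_continuous_onI continuous_intros c\<phi>)
      show "AE z in lebesgue_on \<Omega>. 0 \<le> M * ?\<phi> z" using M nn by simp
      show "AE z in lebesgue_on \<Omega>. norm (?\<phi> z *\<^sub>R g z) \<le> M * ?\<phi> z"
        using g(2)
      proof (rule AE_mp, intro AE_I2 impI)
        fix z assume "norm (g z) \<le> M"
        from mult_right_mono[OF this nn[of "z - s"]]
        show "norm (?\<phi> z *\<^sub>R g z) \<le> M * ?\<phi> z" using nn[of "z - s"] by (simp add: mult.commute)
      qed
    qed
    moreover have "(LINT z|lebesgue_on \<Omega>. M * ?\<phi> z) = M"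
    proof -
      have z: "M * ?\<phi> z = 0" if "z \<notin> \<Omega>" for z using \<phi>0[of z] subsetD[OF sub, of z] that by auto
      have "(LINT z|lebesgue_on \<Omega>. M * ?\<phi> z) = (LBINT z. M * ?\<phi> z)"
        by (rule lebesgue_on_integral_eq(1)[OF \<Omega>' _ z])
          (auto intro!: borel_measurable_continuous_onI continuous_intros c\<phi>)
      also have "(LBINT z. ?\<phi> z) = 1"
        using lborel_integral_translation[of \<eta> "- s"] it(2)
          borel_measurable_continuous_onI[OF smooth_continuous[OF sm]] by simp
      ultimately show ?thesis by simp
    qed
    ultimately show ?thesis by metis
  qed
  have "norm (U x - U y) \<le> M * norm (x - y)"
  proof (rule differentiable_bound[where S="closed_segment x y"])
    show "(U has_derivative (\<lambda>h. h \<bullet> D s)) (at s within closed_segment x y)" for s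
      using U[of s] by (simp add: gderiv_def has_derivative_at_withinI)
    show "onorm (\<lambda>h. h \<bullet> D s) \<le> M" if "s \<in> closed_segment x y" for s
    proof (rule onorm_bound)
      show "0 \<le> M" using D[OF that] norm_ge_zero order_trans by blast
      fix h
      have "norm (h \<bullet> D s) \<le> norm h * norm (D s)" using Cauchy_Schwarz_ineq2 by simp
      also have "\<dots> \<le> norm h * M" by (intro mult_left_mono D[OF that]) simp
      finally show "norm (h \<bullet> D s) \<le> M * norm h" by (simp add: mult.commute)
    qed
  qed auto
  moreover have "\<bar>U x - v x\<bar> \<le> e / 2" unfolding U_def
  proof (rule mollify_close[OF \<eta> v(1)])
    fix z :: 'a assume "norm z \<le> \<delta>"
    then show "\<bar>v (x + z) - v x\<bar> \<le> e / 2" using \<delta> d1(2)[of "x + z"] by (simp add: dist_norm)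
  qed
  moreover have "\<bar>U y - v y\<bar> \<le> e / 2" unfolding U_def
  proof (rule mollify_close[OF \<eta> v(1)])
    fix z :: 'a assume "norm z \<le> \<delta>"
    then show "\<bar>v (y + z) - v y\<bar> \<le> e / 2" using \<delta> d2(2)[of "y + z"] by (simp add: dist_norm)
  qed
  ultimately show "\<bar>v x - v y\<bar> \<le> M * norm (x - y) + e" by (simp add: abs_if split: if_splits)
qed

lemma emeasure_lebesgue_on_open_nonzero:
  fixes \<Omega> :: "'a::euclidean_space set"
  assumes "open \<Omega>" "\<Omega> \<noteq> {}"
  shows "emeasure (lebesgue_on \<Omega>) (space (lebesgue_on \<Omega>)) \<noteq> 0"
proof
  assume "emeasure (lebesgue_on \<Omega>) (space (lebesgue_on \<Omega>)) = 0"
  then have "\<Omega> \<in> null_sets lebesgue"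
    using assms(1) by (simp add: emeasure_restrict_space null_setsI)
  then have "negligible \<Omega>" by (simp add: negligible_iff_null_sets)
  then show False using open_not_negligible[OF assms] by simp
qed

text \<open>The open segment from \<open>x\<close> to the nearest point \<open>z\<close> of the complement lies in \<open>\<Omega>\<close>, and \<open>z\<close> is on the boundary,
where the continuous representative vanishes. The Lipschitz bound along \<open>[x, w]\<close> with \<open>w\<close> tending to \<open>z\<close> gives the claim.\<close>

lemma Linf_norm_le_inradius:
  fixes \<Omega> :: "'a::euclidean_space set"
  assumes \<Omega>: "open \<Omega>" "bounded \<Omega>" "\<Omega> \<noteq> {}" and u: "u \<in> W1inf_0 \<Omega>"
    and g: "g \<in> Linf_space (lebesgue_on \<Omega>)" "has_weak_gradient \<Omega> u g"
  shows "Linf_norm (lebesgue_on \<Omega>) u \<le> inradius \<Omega> * Linf_norm (lebesgue_on \<Omega>) g"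
proof -
  note nz = emeasure_lebesgue_on_open_nonzero[OF \<Omega>(1,3)]
  define M where "M = Linf_norm (lebesgue_on \<Omega>) g"
  have M: "AE x in lebesgue_on \<Omega>. norm (g x) \<le> M" "0 \<le> M"
    unfolding M_def using Linf_norm_AE[OF g(1) nz] by auto
  obtain v0 where v0: "continuous_on (closure \<Omega>) v0" "AE x in lebesgue_on \<Omega>. u x = v0 x"
      "\<And>x. x \<in> frontier \<Omega> \<Longrightarrow> v0 x = 0"
    using u unfolding W1inf_0_def by blast
  \<comment> \<open>The boundary condition makes the extension by 0 continuous on the whole space.\<close>
  define v where "v x = (if x \<in> \<Omega> then v0 x else 0)" for x
  have fr: "x \<in> frontier \<Omega>" if "x \<in> closure \<Omega>" "x \<notin> \<Omega>" for x
    using that \<Omega>(1) by (simp add: frontier_def interior_open)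
  have "continuous_on (closure \<Omega> \<union> - \<Omega>) v"
    unfolding v_def
    by (rule continuous_on_cases) (use v0 fr \<Omega>(1) in auto)
  moreover have "closure \<Omega> \<union> - \<Omega> = UNIV" using closure_subset[of \<Omega>] by blast
  ultimately have cv: "continuous_on UNIV v" by simp
  have v_out: "v x = 0" if "x \<notin> \<Omega>" for x using that by (simp add: v_def)
  have uv: "AE x in lebesgue_on \<Omega>. u x = v x"
    using v0(2) AE_space by eventually_elim (simp add: v_def)
  have u_meas: "u \<in> borel_measurable (lebesgue_on \<Omega>)"
    using u by (simp add: W1inf_0_def W1inf_def Linf_space_def)
  have bound: "\<bar>v x\<bar> \<le> inradius \<Omega> * M" if x: "x \<in> \<Omega>" for x
  proof -
    obtain z where z: "z \<notin> \<Omega>" "dist x z = infdist x (- \<Omega>)" "ball x (dist x z) \<subseteq> \<Omega>"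
      using nearest_exterior_point[OF \<Omega>(1,2)] by metis
    have xz: "dist x z > 0" using x z(1) by (metis zero_less_dist_iff)
    define w where "w t = x + t *\<^sub>R (z - x)" for t :: real
    have "((\<lambda>t. \<bar>v x - v (w t)\<bar>) \<longlongrightarrow> \<bar>v x - v (w 1)\<bar>) (at_left 1)"
    proof -
      have "continuous_on UNIV (\<lambda>t. \<bar>v x - v (w t)\<bar>)"
        unfolding w_def by (intro continuous_intros continuous_on_compose2[OF cv]) auto
      then have "((\<lambda>t. \<bar>v x - v (w t)\<bar>) \<longlongrightarrow> \<bar>v x - v (w 1)\<bar>) (at 1)"
        by (simp add: continuous_on_def)
      then show ?thesis by (rule tendsto_within_subset) simp
    qed
    moreover have "\<forall>\<^sub>F t in at_left 1. \<bar>v x - v (w t)\<bar> \<le> M * dist x z"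
    proof -
      have "\<bar>v x - v (w t)\<bar> \<le> M * dist x z" if t: "0 < t" "t < 1" for t
      proof -
        have n: "norm (x - w t) = t * dist x z"
          using t by (simp add: w_def dist_norm norm_minus_commute)
        have "w t \<in> ball x (dist x z)" using n t xz by (simp add: dist_norm)
        then have "closed_segment x (w t) \<subseteq> \<Omega>"
          using xz z(3) by (intro subset_trans[OF closed_segment_subset[of x "ball x (dist x z)"]]) auto
        from weak_gradient_segment_lipschitz[OF \<Omega>(1) cv v_out u_meas uv g(2) M(1,2) this]
        have "\<bar>v x - v (w t)\<bar> \<le> M * (t * dist x z)" by (simp add: n)
        also have "\<dots> \<le> M * dist x z"
          using M(2) t xz by (intro mult_left_mono) (auto simp: mult_left_le_one_le)
        finally show ?thesis .
      qed
      then show ?thesis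
        using eventually_at_left_real[of 0 1] by (auto elim!: eventually_mono)
    qed
    ultimately have "\<bar>v x - v (w 1)\<bar> \<le> M * dist x z" by (rule tendsto_upperbound) simp
    also have "\<dots> \<le> M * inradius \<Omega>"
      using infdist_le_inradius[OF \<Omega>(2) x] M(2) z(2) by (intro mult_left_mono) auto
    finally show ?thesis using z(1) by (simp add: w_def v_def mult.commute)
  qed
  have "AE x in lebesgue_on \<Omega>. norm (u x) \<le> inradius \<Omega> * M"
    using uv AE_space by eventually_elim (use bound in simp)
  then show ?thesis unfolding M_def[symmetric] by (rule Linf_norm_leI(2)[OF u_meas _ nz])
qed

lemma AE_imp_ball:
  fixes \<Omega> :: "'a::euclidean_space set"
  assumes "open \<Omega>" "AE x in lebesgue_on \<Omega>. P x" "s > 0" "ball x0 s \<subseteq> \<Omega>"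
  shows "\<exists>x\<in>ball x0 s. P x"
proof (rule ccontr)
  assume not_P: "\<not> ?thesis"
  have "AE x in lebesgue. x \<in> \<Omega> \<longrightarrow> P x"
    using assms(1,2) by (subst (asm) AE_restrict_space_iff) auto
  then have "AE x in lebesgue. x \<notin> ball x0 s"
    by eventually_elim (use assms(4) not_P in blast)
  then have "ball x0 s \<in> null_sets lebesgue" by (subst (asm) AE_iff_null_sets[symmetric]) auto
  then have "negligible (ball x0 s)" by (simp add: negligible_iff_null_sets)
  then show False using open_not_negligible[of "ball x0 s"] assms(3) by simp
qed

lemma test_fun_W1inf_0:
  fixes \<Omega> :: "'a::euclidean_space set"
  assumes \<Omega>: "open \<Omega>" "\<Omega> \<noteq> {}" and \<phi>: "test_fun \<Omega> \<phi>"
  shows "\<phi> \<in> W1inf_0 \<Omega>" "gradient \<phi> \<in> Linf_space (lebesgue_on \<Omega>)"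
proof -
  note nz = emeasure_lebesgue_on_open_nonzero[OF \<Omega>]
  obtain K where K: "smooth \<phi>" "compact K" "K \<subseteq> \<Omega>" "\<And>x. x \<notin> K \<Longrightarrow> \<phi> x = 0"
      "\<And>x. x \<notin> K \<Longrightarrow> gradient \<phi> x = 0"
    using test_funE[OF \<phi>] by metis
  have c: "continuous_on A \<phi>" "continuous_on A (gradient \<phi>)" for A
    using K(1) by (auto intro: smooth_continuous continuous_on_gradient)
  have bd: "f \<in> Linf_space (lebesgue_on \<Omega>)"
    if f: "continuous_on UNIV f" "\<And>x. x \<notin> K \<Longrightarrow> f x = 0" for f :: "'a \<Rightarrow> 'b::euclidean_space"
  proof -
    have "bounded (f ` K)"
      by (intro compact_imp_bounded compact_continuous_image K continuous_on_subset[OF f(1)]) simp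
    then obtain B where "\<And>x. x \<in> K \<Longrightarrow> norm (f x) \<le> B" by (auto simp: bounded_iff)
    then have B: "norm (f x) \<le> max 0 B" for x using f(2)[of x] by (cases "x \<in> K") force+
    have "f \<in> borel_measurable (lebesgue_on \<Omega>)"
      using \<Omega>(1) by (intro continuous_imp_measurable_on_sets_lebesgue continuous_on_subset[OF f(1)]) auto
    from Linf_norm_leI(1)[OF this _ nz, of "max 0 B"] show ?thesis using B by simp
  qed
  show g: "gradient \<phi> \<in> Linf_space (lebesgue_on \<Omega>)" by (rule bd) (use c K in auto)
  have "\<phi> \<in> Linf_space (lebesgue_on \<Omega>)" by (rule bd) (use c K in auto)
  then have "\<phi> \<in> W1inf \<Omega>"
    using g test_fun_weak_gradient[OF \<Omega>(1) \<phi>] by (auto simp: W1inf_def)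
  moreover have "\<phi> x = 0" if "x \<in> frontier \<Omega>" for x
    using that K(3,4) \<Omega>(1) by (auto simp: frontier_def interior_open)
  ultimately show "\<phi> \<in> W1inf_0 \<Omega>" using c(1) by (auto simp: W1inf_0_def)
qed

lemma lambda_1inf_eq:
  fixes \<Omega> :: "'a::euclidean_space set"
  assumes \<Omega>: "open \<Omega>" "bounded \<Omega>" "\<Omega> \<noteq> {}"
  shows "lambda_1inf \<Omega> = 1 / inradius \<Omega>"
proof -
  let ?M = "lebesgue_on \<Omega>"
  note nz = emeasure_lebesgue_on_open_nonzero[OF \<Omega>(1,3)]
  note Rpos = inradius_pos[OF \<Omega>]
  define Q where "Q = {Linf_norm ?M g / Linf_norm ?M u | u g.
     u \<in> W1inf_0 \<Omega> \<and> g \<in> Linf_space ?M \<and>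
     has_weak_gradient \<Omega> u g \<and> \<not> (AE x in ?M. u x = 0)}"
  have lower: "1 / inradius \<Omega> \<le> y" if yQ: "y \<in> Q" for y
  proof -
    obtain u g where y: "y = Linf_norm ?M g / Linf_norm ?M u" and u: "u \<in> W1inf_0 \<Omega>"
        and g: "g \<in> Linf_space ?M" "has_weak_gradient \<Omega> u g" and n0: "\<not> (AE x in ?M. u x = 0)"
      using yQ unfolding Q_def by blast
    have "u \<in> Linf_space ?M" using u by (simp add: W1inf_0_def W1inf_def)
    note AE_u = Linf_norm_AE[OF this nz]
    have "Linf_norm ?M u \<noteq> 0"
    proof
      assume "Linf_norm ?M u = 0"
      with AE_u(1) have "AE x in ?M. u x = 0" by simp
      with n0 show False by simp
    qed
    with AE_u(2) have "Linf_norm ?M u > 0" by simp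
    then show ?thesis
      using Linf_norm_le_inradius[OF \<Omega> u g] Rpos by (simp add: y field_simps)
  qed
  have upper: "\<exists>y\<in>Q. y \<le> 1 / r" if r: "0 < r" "r < inradius \<Omega>" for r
  proof -
    obtain \<phi> x0 s where \<phi>: "test_fun \<Omega> \<phi>" "\<And>x. norm (gradient \<phi> x) \<le> 1"
      and s: "s > 0" "ball x0 s \<subseteq> \<Omega>" "\<And>x. x \<in> ball x0 s \<Longrightarrow> r \<le> \<phi> x"
      using smooth_cone_exists[OF \<Omega> r(2)] by metis
    note W = test_fun_W1inf_0[OF \<Omega>(1,3) \<phi>(1)]
    have "\<phi> \<in> Linf_space ?M" using W(1) by (simp add: W1inf_0_def W1inf_def)
    note AE_\<phi> = Linf_norm_AE(1)[OF this nz]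
    obtain x where "x \<in> ball x0 s" "norm (\<phi> x) \<le> Linf_norm ?M \<phi>"
      using AE_imp_ball[OF \<Omega>(1) AE_\<phi> s(1,2)] by blast
    then have ge: "r \<le> Linf_norm ?M \<phi>" using s(3)[of x] by simp
    have "\<not> (AE x in ?M. \<phi> x = 0)"
      using AE_imp_ball[OF \<Omega>(1) _ s(1,2)] s(3) r(1) by force
    then have mem: "Linf_norm ?M (gradient \<phi>) / Linf_norm ?M \<phi> \<in> Q"
      using W test_fun_weak_gradient[OF \<Omega>(1) \<phi>(1)] unfolding Q_def by blast
    have "Linf_norm ?M (gradient \<phi>) \<le> 1"
      using W(2) \<phi>(2) by (intro Linf_norm_leI(2)[OF _ _ nz]) (auto simp: Linf_space_def)
    then have "Linf_norm ?M (gradient \<phi>) / Linf_norm ?M \<phi> \<le> 1 / r"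
      using ge r(1) Linf_norm_AE(2)[OF W(2) nz] by (intro frac_le) auto
    then show ?thesis using mem by blast
  qed
  have bdd: "bdd_below Q" using lower by (rule bdd_belowI)
  have "Q \<noteq> {}" using upper[of "inradius \<Omega> / 2"] Rpos by auto
  then have ge: "1 / inradius \<Omega> \<le> Inf Q" using lower by (intro cInf_greatest) auto
  have "Inf Q \<le> 1 / inradius \<Omega>"
  proof (rule ccontr)
    assume "\<not> Inf Q \<le> 1 / inradius \<Omega>"
    moreover have "0 < Inf Q" using ge Rpos by (meson order_less_le_trans zero_less_divide_1_iff)
    ultimately have "1 / Inf Q < inradius \<Omega>" using Rpos by (simp add: field_simps)
    then obtain r where r: "1 / Inf Q < r" "r < inradius \<Omega>" using dense by blast
    then have "0 < r" using \<open>0 < Inf Q\<close> by (meson order.strict_trans zero_less_divide_1_iff)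
    with upper r(2) obtain y where "y \<in> Q" "y \<le> 1 / r" by blast
    then have "Inf Q \<le> 1 / r" using cInf_lower[OF _ bdd] by force
    then show False using r(1) \<open>0 < r\<close> \<open>0 < Inf Q\<close> by (simp add: field_simps)
  qed
  with ge show ?thesis unfolding lambda_1inf_def Q_def[symmetric] by simp
qed

section \<open>Limits of test functions in Lebesgue norms\<close>

text \<open>Convexity of \<open>t \<mapsto> t powr p\<close>, applied to \<open>a + b = (1 - \<theta>) (a / (1 - \<theta>)) + \<theta> (b / \<theta>)\<close>. The free parameter makes it
a substitute for Minkowski's inequality: for small \<open>\<theta>\<close> the factor of \<open>a powr p\<close> is close to 1.\<close>

lemma powr_add_le:
  fixes a b :: real
  assumes "p \<ge> 1" "0 < \<theta>" "\<theta> < 1" "0 \<le> a" "0 \<le> b"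
  shows "(a + b) powr p \<le> (1 - \<theta>) powr (1 - p) * a powr p + \<theta> powr (1 - p) * b powr p"
proof -
  have one_le: "1 \<le> t powr (1 - p)" if "0 < t" "t \<le> 1" for t
    using powr_mono_both'[of "1 - p" 0 t 1] that assms(1) powr_mono2'[of "1 - p" t 1] by simp
  consider "a = 0" | "b = 0" | "a > 0" "b > 0" using assms by linarith
  then show ?thesis
  proof cases
    case 1
    then show ?thesis
      using one_le[of \<theta>] assms mult_right_mono[of 1 "\<theta> powr (1 - p)" "b powr p"] by simp
  next
    case 2
    then show ?thesis
      using one_le[of "1 - \<theta>"] assms mult_right_mono[of 1 "(1 - \<theta>) powr (1 - p)" "a powr p"] by simp
  next
    case 3
    have "((1 - \<theta>) *\<^sub>R (a / (1 - \<theta>)) + \<theta> *\<^sub>R (b / \<theta>)) powr p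
        \<le> (1 - \<theta>) * (a / (1 - \<theta>)) powr p + \<theta> * (b / \<theta>) powr p"
      by (rule convex_onD[OF powr_convex[OF assms(1)]]) (use 3 assms in auto)
    then show ?thesis
      using assms 3 by (simp add: powr_divide powr_diff)
  qed
qed

lemma Lp_norm_powr:
  assumes "p > 0"
  shows "Lp_norm p M f powr p = (LINT x|M. norm (f x) powr p)"
  using assms by (simp add: Lp_norm_def powr_powr)

lemma Lp_norm_nonneg: "0 \<le> Lp_norm p M f"
  by (simp add: Lp_norm_def)

lemma Lp_space_diff:
  assumes p: "p \<ge> 1" and f: "f \<in> Lp_space p M" and h: "h \<in> Lp_space p M"
  shows "(\<lambda>x. f x - h x) \<in> Lp_space p M"
proof -
  have [measurable]: "f \<in> borel_measurable M" "h \<in> borel_measurable M"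
    using f h by (auto simp: Lp_space_def)
  let ?c = "(1 / 2) powr (1 - p) :: real"
  have "integrable M (\<lambda>x. norm (f x - h x) powr p)"
  proof (rule Bochner_Integration.integrable_bound)
    show "integrable M (\<lambda>x. ?c * norm (f x) powr p + ?c * norm (h x) powr p)"
      using f h by (auto simp: Lp_space_def)
    have "norm (f x - h x) powr p \<le> ?c * norm (f x) powr p + ?c * norm (h x) powr p" for x
    proof -
      have "norm (f x - h x) powr p \<le> (norm (f x) + norm (h x)) powr p"
        using p by (intro powr_mono2 norm_triangle_ineq4) auto
      also have "\<dots> \<le> ?c * norm (f x) powr p + ?c * norm (h x) powr p"
        using powr_add_le[OF p, of "1/2" "norm (f x)" "norm (h x)"] by simp
      finally show ?thesis .
    qed
    then show "AE x in M. norm (norm (f x - h x) powr p)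
        \<le> norm (?c * norm (f x) powr p + ?c * norm (h x) powr p)"
      by (intro AE_I2) (simp add: order_trans[OF _ abs_ge_self])
  qed measurable
  then show ?thesis by (simp add: Lp_space_def)
qed

lemma Lp_integral_split:
  assumes p: "p \<ge> 1" and \<theta>: "0 < \<theta>" "\<theta> < 1" and f: "f \<in> Lp_space p M" and h: "h \<in> Lp_space p M"
  shows "(LINT x|M. norm (f x) powr p) \<le> (1 - \<theta>) powr (1 - p) * (LINT x|M. norm (h x) powr p)
    + \<theta> powr (1 - p) * (LINT x|M. norm (f x - h x) powr p)"
proof -
  have d: "integrable M (\<lambda>x. norm (f x - h x) powr p)"
    using Lp_space_diff[OF p f h] by (simp add: Lp_space_def)
  have i: "integrable M (\<lambda>x. norm (f x) powr p)" "integrable M (\<lambda>x. norm (h x) powr p)"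
    using f h by (auto simp: Lp_space_def)
  have "(LINT x|M. norm (f x) powr p) \<le> (LINT x|M. (1 - \<theta>) powr (1 - p) * norm (h x) powr p
      + \<theta> powr (1 - p) * norm (f x - h x) powr p)"
  proof (rule integral_mono)
    fix x
    have "norm (f x) powr p \<le> (norm (h x) + norm (f x - h x)) powr p"
      using p norm_triangle_ineq[of "h x" "f x - h x"] by (intro powr_mono2) auto
    also have "\<dots> \<le> (1 - \<theta>) powr (1 - p) * norm (h x) powr p + \<theta> powr (1 - p) * norm (f x - h x) powr p"
      by (rule powr_add_le[OF p \<theta>]) auto
    finally show "norm (f x) powr p
        \<le> (1 - \<theta>) powr (1 - p) * norm (h x) powr p + \<theta> powr (1 - p) * norm (f x - h x) powr p" .
  qed (use i d in auto)
  also have "\<dots> = (1 - \<theta>) powr (1 - p) * (LINT x|M. norm (h x) powr p)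
    + \<theta> powr (1 - p) * (LINT x|M. norm (f x - h x) powr p)"
    using i d by simp
  finally show ?thesis .
qed

text \<open>Fix \<open>\<theta>\<close> so small that the main term stays below \<open>N powr p\<close>; the error term then vanishes in the limit.\<close>

lemma eventually_Lp_norm_less:
  assumes p: "p \<ge> 1" and f: "\<And>k. f k \<in> Lp_space p M" and h: "h \<in> Lp_space p M"
    and lim: "(\<lambda>k. Lp_norm p M (\<lambda>x. f k x - h x)) \<longlonglongrightarrow> 0" and N: "Lp_norm p M h < N"
  shows "\<forall>\<^sub>F k in sequentially. (LINT x|M. norm (f k x) powr p) < N powr p"
proof -
  let ?I = "LINT x|M. norm (h x) powr p"
  let ?d = "\<lambda>k. LINT x|M. norm (f k x - h x) powr p"
  have I: "?I < N powr p"
    using powr_less_mono2[OF _ Lp_norm_nonneg N, of p] p by (simp add: Lp_norm_powr)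
  have "((\<lambda>\<theta>. (1 - \<theta>) powr (1 - p) * ?I) \<longlongrightarrow> (1 - 0) powr (1 - p) * ?I) (at_right 0)"
    by (intro tendsto_intros) simp
  then have "((\<lambda>\<theta>. (1 - \<theta>) powr (1 - p) * ?I) \<longlongrightarrow> ?I) (at_right 0)" by simp
  then have "\<forall>\<^sub>F \<theta> in at_right 0. (1 - \<theta>) powr (1 - p) * ?I < N powr p"
    using I by (rule order_tendstoD)
  moreover have "\<forall>\<^sub>F \<theta> in at_right (0::real). \<theta> \<in> {0<..<1}"
    by (rule eventually_at_right_real) simp
  ultimately have "\<forall>\<^sub>F \<theta> in at_right 0. (1 - \<theta>) powr (1 - p) * ?I < N powr p \<and> \<theta> \<in> {0<..<1}"
    by (rule eventually_conj)
  then obtain \<theta> where \<theta>: "(1 - \<theta>) powr (1 - p) * ?I < N powr p" "0 < \<theta>" "\<theta> < 1"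
    using eventually_happens[of _ "at_right (0::real)"] by auto
  have "(\<lambda>k. Lp_norm p M (\<lambda>x. f k x - h x) powr p) \<longlonglongrightarrow> 0 powr p"
    using p by (intro tendsto_powr' lim tendsto_const) (auto simp: Lp_norm_nonneg)
  then have "?d \<longlonglongrightarrow> 0" using p by (simp add: Lp_norm_powr)
  then have "(\<lambda>k. (1 - \<theta>) powr (1 - p) * ?I + \<theta> powr (1 - p) * ?d k)
      \<longlonglongrightarrow> (1 - \<theta>) powr (1 - p) * ?I + \<theta> powr (1 - p) * 0"
    by (intro tendsto_intros)
  then have "\<forall>\<^sub>F k in sequentially. (1 - \<theta>) powr (1 - p) * ?I + \<theta> powr (1 - p) * ?d k < N powr p"
    by (rule order_tendstoD) (use \<theta> in simp)
  then show ?thesis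
    by eventually_elim (rule order_le_less_trans[OF Lp_integral_split[OF p \<theta>(2,3) f h]])
qed

text \<open>The excess of \<open>\<bar>u\<bar>\<close> over \<open>S\<close> is eventually at most \<open>\<bar>f k - u\<bar>\<close>, so its \<open>p\<close>-th power integrates to 0; no almost
everywhere convergent subsequence has to be extracted.\<close>

lemma AE_le_of_Lp_limit:
  fixes u :: "'a \<Rightarrow> real"
  assumes p: "p \<ge> 1" and f: "\<And>k. f k \<in> Lp_space p M" and u: "u \<in> Lp_space p M"
    and lim: "(\<lambda>k. Lp_norm p M (\<lambda>x. f k x - u x)) \<longlonglongrightarrow> 0"
    and S: "0 \<le> S" "\<forall>\<^sub>F k in sequentially. \<forall>x\<in>space M. \<bar>f k x\<bar> \<le> S"
  shows "AE x in M. \<bar>u x\<bar> \<le> S"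
proof -
  have [measurable]: "u \<in> borel_measurable M" using u by (simp add: Lp_space_def)
  \<comment> \<open>The part of \<open>\<bar>u\<bar>\<close> above \<open>S\<close>; it is to vanish almost everywhere.\<close>
  define m where "m x = max 0 (\<bar>u x\<bar> - S)" for x
  have m: "0 \<le> m x" for x by (simp add: m_def)
  have mi: "integrable M (\<lambda>x. m x powr p)"
  proof (rule Bochner_Integration.integrable_bound)
    show "integrable M (\<lambda>x. norm (u x) powr p)" using u by (simp add: Lp_space_def)
    show "(\<lambda>x. m x powr p) \<in> borel_measurable M" unfolding m_def by measurable
    show "AE x in M. norm (m x powr p) \<le> norm (norm (u x) powr p)"
      using S(1) p m by (intro AE_I2) (auto simp: m_def intro!: powr_mono2)
  qed
  have "(\<lambda>k. Lp_norm p M (\<lambda>x. f k x - u x) powr p) \<longlonglongrightarrow> 0 powr p"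
    using p by (intro tendsto_powr' lim tendsto_const) (auto simp: Lp_norm_nonneg)
  then have lim': "(\<lambda>k. LINT x|M. norm (f k x - u x) powr p) \<longlonglongrightarrow> 0"
    using p by (simp add: Lp_norm_powr)
  have "\<forall>\<^sub>F k in sequentially. (LINT x|M. m x powr p) \<le> (LINT x|M. norm (f k x - u x) powr p)"
    using S(2)
  proof eventually_elim
    case (elim k)
    show ?case
    proof (rule integral_mono[OF mi])
      show "integrable M (\<lambda>x. norm (f k x - u x) powr p)"
        using Lp_space_diff[OF p f u] by (simp add: Lp_space_def)
      fix x assume "x \<in> space M"
      then have "\<bar>f k x\<bar> \<le> S" using elim by blast
      then have "m x \<le> norm (f k x - u x)" unfolding m_def real_norm_def by linarith
      then show "m x powr p \<le> norm (f k x - u x) powr p" using p m by (intro powr_mono2) auto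
    qed
  qed
  then have "(LINT x|M. m x powr p) \<le> 0" by (rule tendsto_lowerbound[OF lim']) simp
  moreover have "0 \<le> (LINT x|M. m x powr p)" by simp
  ultimately have "(LINT x|M. m x powr p) = 0" by simp
  then have "AE x in M. m x powr p = 0"
    by (subst (asm) integral_nonneg_eq_0_iff_AE[OF mi]) auto
  then show ?thesis
    by eventually_elim (auto simp: m_def max_def split: if_splits)
qed

section \<open>The supremum bound in the Sobolev space\<close>

lemma test_fun_Lp_space:
  fixes \<Omega> :: "'a::euclidean_space set"
  assumes \<Omega>: "open \<Omega>" and \<phi>: "test_fun \<Omega> \<phi>" and p: "p > 0"
  shows "\<phi> \<in> Lp_space p (lebesgue_on \<Omega>)" "gradient \<phi> \<in> Lp_space p (lebesgue_on \<Omega>)"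
    "(LINT x|lebesgue_on \<Omega>. norm (gradient \<phi> x) powr p) = (LBINT x. norm (gradient \<phi> x) powr p)"
proof -
  have \<Omega>': "\<Omega> \<in> sets lebesgue" using \<Omega> by simp
  obtain K where K: "smooth \<phi>" "compact K" "K \<subseteq> \<Omega>" "\<And>x. x \<notin> K \<Longrightarrow> \<phi> x = 0"
      "\<And>x. x \<notin> K \<Longrightarrow> gradient \<phi> x = 0"
    using test_funE[OF \<phi>] by metis
  have c: "continuous_on A \<phi>" "continuous_on A (gradient \<phi>)" for A
    using K(1) by (auto intro: smooth_continuous continuous_on_gradient)
  have Lp: "f \<in> Lp_space p (lebesgue_on \<Omega>)"
    "(LINT x|lebesgue_on \<Omega>. norm (f x) powr p) = (LBINT x. norm (f x) powr p)"
    if f: "continuous_on UNIV f" "\<And>x. x \<notin> K \<Longrightarrow> f x = 0" for f :: "'a \<Rightarrow> 'b::euclidean_space"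
  proof -
    have cf: "continuous_on UNIV (\<lambda>x. norm (f x) powr p)"
      by (intro continuous_on_powr' continuous_intros f(1)) (use p in auto)
    have m: "(\<lambda>x. norm (f x) powr p) \<in> borel_measurable borel"
      by (rule borel_measurable_continuous_onI[OF cf])
    have z: "norm (f x) powr p = 0" if "x \<notin> K" for x using f(2)[OF that] by simp
    have i: "integrable lborel (\<lambda>x. norm (f x) powr p)"
      by (rule compact_support_integrable[OF cf K(2) z])
    have z': "norm (f x) powr p = 0" if "x \<notin> \<Omega>" for x using z that K(3) by blast
    show "(LINT x|lebesgue_on \<Omega>. norm (f x) powr p) = (LBINT x. norm (f x) powr p)"
      by (rule lebesgue_on_integral_eq(1)[OF \<Omega>' m z'])
    have "f \<in> borel_measurable (lebesgue_on \<Omega>)"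
      using \<Omega>' by (intro continuous_imp_measurable_on_sets_lebesgue continuous_on_subset[OF f(1)]) auto
    then show "f \<in> Lp_space p (lebesgue_on \<Omega>)"
      using lebesgue_on_integral_eq(2)[OF \<Omega>' m z'] i by (simp add: Lp_space_def)
  qed
  show "\<phi> \<in> Lp_space p (lebesgue_on \<Omega>)" by (rule Lp(1)) (use c K in auto)
  show "gradient \<phi> \<in> Lp_space p (lebesgue_on \<Omega>)" by (rule Lp(1)) (use c K in auto)
  show "(LINT x|lebesgue_on \<Omega>. norm (gradient \<phi> x) powr p) = (LBINT x. norm (gradient \<phi> x) powr p)"
    by (rule Lp(2)) (use c K in auto)
qed

lemma test_fun_W1p_0:
  fixes \<Omega> :: "'a::euclidean_space set"
  assumes \<Omega>: "open \<Omega>" and \<phi>: "test_fun \<Omega> \<phi>" and p: "p > 0"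
  shows "\<phi> \<in> W1p_0 p \<Omega>"
proof -
  note L = test_fun_Lp_space[OF assms] and w = test_fun_weak_gradient[OF \<Omega> \<phi>]
  have "\<phi> \<in> W1p p \<Omega>" using L w by (auto simp: W1p_def)
  then show ?thesis
    unfolding W1p_0_def using L(2) w \<phi> p
    by (auto intro!: bexI[of _ "gradient \<phi>"] exI[of _ "\<lambda>_. \<phi>"] simp: Lp_norm_def)
qed

text \<open>The pointwise bound for test functions survives both limits. The gradients of the approximating test functions
converge to some weak gradient of \<open>u\<close>, which agrees with \<open>g\<close> almost everywhere by uniqueness.\<close>

lemma W1p_0_AE_bound:
  fixes \<Omega> :: "'a::euclidean_space set"
  assumes \<Omega>: "open \<Omega>" "bounded \<Omega>" "\<Omega> \<noteq> {}" and p: "real DIM('a) < p" and \<delta>: "0 < \<delta>"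
    and u: "u \<in> W1p_0 p \<Omega>" and g: "g \<in> Lp_space p (lebesgue_on \<Omega>)" "has_weak_gradient \<Omega> u g"
    and N: "Lp_norm p (lebesgue_on \<Omega>) g < N"
  shows "AE x in lebesgue_on \<Omega>. \<bar>u x\<bar> \<le> (inradius \<Omega> + 2 * \<delta>) * box_factor TYPE('a) \<delta> p * N"
proof -
  let ?M = "lebesgue_on \<Omega>"
  have p1: "p \<ge> 1" using p DIM_positive[where 'a='a] by linarith
  have Npos: "N > 0" using N Lp_norm_nonneg[of p ?M g] by linarith
  obtain g0 \<phi> where g0: "g0 \<in> Lp_space p ?M" "has_weak_gradient \<Omega> u g0"
    and \<phi>: "\<And>k::nat. test_fun \<Omega> (\<phi> k)"
    and lim: "(\<lambda>k. Lp_norm p ?M (\<lambda>x. \<phi> k x - u x)) \<longlonglongrightarrow> 0"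
      "(\<lambda>k. Lp_norm p ?M (\<lambda>x. gradient (\<phi> k) x - g0 x)) \<longlonglongrightarrow> 0"
    using u unfolding W1p_0_def by blast
  have "AE x in ?M. g x = g0 x"
    using weak_gradient_unique[OF \<Omega>(1,2) g(2) _ g0(2)] g(1) g0(1) by (simp add: Lp_space_def)
  then have "(LINT x|?M. norm (g0 x) powr p) = (LINT x|?M. norm (g x) powr p)"
    using g(1) g0(1) by (intro integral_cong_AE) (auto simp: Lp_space_def)
  then have N0: "Lp_norm p ?M g0 < N" using N by (simp add: Lp_norm_def)
  have Lp: "\<phi> k \<in> Lp_space p ?M" "gradient (\<phi> k) \<in> Lp_space p ?M" for k
    using test_fun_Lp_space[OF \<Omega>(1) \<phi>] p1 by auto
  let ?S = "(inradius \<Omega> + 2 * \<delta>) * box_factor TYPE('a) \<delta> p * N"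
  show ?thesis
  proof (rule AE_le_of_Lp_limit[OF p1 Lp(1) _ lim(1)])
    show "u \<in> Lp_space p ?M" using u by (simp add: W1p_0_def W1p_def)
    show "0 \<le> ?S"
      using inradius_pos[OF \<Omega>] \<delta> Npos p p1 by (simp add: box_factor_def)
    show "\<forall>\<^sub>F k in sequentially. \<forall>x\<in>space ?M. \<bar>\<phi> k x\<bar> \<le> ?S"
      using eventually_Lp_norm_less[OF p1 Lp(2) g0(1) lim(2) N0]
    proof eventually_elim
      case (elim k)
      show ?case
      proof
        fix x assume "x \<in> space ?M"
        then have x: "x \<in> \<Omega>" by simp
        obtain z where z: "z \<notin> \<Omega>" "dist x z = infdist x (- \<Omega>)"
          using nearest_exterior_point[OF \<Omega>(1,2)] by metis
        obtain K r where K: "smooth (\<phi> k)" "K \<subseteq> \<Omega>" "\<And>x. x \<notin> K \<Longrightarrow> \<phi> k x = 0" "K \<subseteq> cball 0 r"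
          using test_funE[OF \<phi>[of k]] by metis
        show "\<bar>\<phi> k x\<bar> \<le> ?S"
        proof (rule pointwise_bound[OF smooth_gradient[OF K(1)] continuous_on_gradient[OF K(1)], where r=r and z=z])
          show "\<phi> k y = 0" if "y \<notin> cball 0 r" for y using K that by blast
          show "\<phi> k z = 0" using K z(1) by blast
          show "norm (x - z) \<le> inradius \<Omega>"
            using infdist_le_inradius[OF \<Omega>(2) x] z(2) by (simp add: dist_norm)
          show "(LBINT y. norm (gradient (\<phi> k) y) powr p) \<le> N powr p"
            using elim test_fun_Lp_space(3)[OF \<Omega>(1) \<phi>[of k], of p] p1 by simp
        qed (use \<delta> p Npos in auto)
      qed
    qed
  qed
qed

section \<open>Bounds for the variational quantity\<close>

lemma finite_measure_lebesgue_on_bounded: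
  fixes \<Omega> :: "'a::euclidean_space set"
  assumes "open \<Omega>" "bounded \<Omega>"
  shows "finite_measure (lebesgue_on \<Omega>)"
  using lmeasurable_open[OF assms(2,1)] by (rule finite_measure_lebesgue_on)

lemma measure_open_pos:
  fixes \<Omega> :: "'a::euclidean_space set"
  assumes "open \<Omega>" "bounded \<Omega>" "\<Omega> \<noteq> {}"
  shows "0 < measure lebesgue \<Omega>"
  using open_not_negligible[OF assms(1,3)] negligible_iff_measure0[OF lmeasurable_open[OF assms(2,1)]]
  by (simp add: zero_less_measure_iff less_le)

lemma Lp_norm_le_of_AE:
  fixes \<Omega> :: "'a::euclidean_space set" and u :: "'a \<Rightarrow> real"
  assumes \<Omega>: "open \<Omega>" "bounded \<Omega>" and q: "q > 0" and S: "AE x in lebesgue_on \<Omega>. \<bar>u x\<bar> \<le> S" "0 \<le> S"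
  shows "Lp_norm q (lebesgue_on \<Omega>) u \<le> measure lebesgue \<Omega> powr (1 / q) * S"
proof -
  interpret finite_measure "lebesgue_on \<Omega>" by (rule finite_measure_lebesgue_on_bounded[OF \<Omega>])
  have "(LINT x|lebesgue_on \<Omega>. norm (u x) powr q) \<le> (LINT x|lebesgue_on \<Omega>. S powr q)"
  proof (rule integral_mono_AE')
    show "AE x in lebesgue_on \<Omega>. norm (u x) powr q \<le> S powr q"
      using S(1) by eventually_elim (use q in \<open>auto intro!: powr_mono2\<close>)
  qed auto
  also have "\<dots> = measure lebesgue \<Omega> * S powr q"
    using \<Omega>(1) by (simp add: measure_restrict_space)
  finally have "Lp_norm q (lebesgue_on \<Omega>) u \<le> (measure lebesgue \<Omega> * S powr q) powr (1 / q)"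
    unfolding Lp_norm_def using q by (intro powr_mono2) auto
  also have "\<dots> = measure lebesgue \<Omega> powr (1 / q) * S"
    using q S(2) by (simp add: powr_mult powr_powr)
  finally show ?thesis .
qed

definition energies :: "real \<Rightarrow> real \<Rightarrow> 'a::euclidean_space set \<Rightarrow> real set" where
  "energies p q \<Omega> = {LINT x|lebesgue_on \<Omega>. norm (g x) powr p | u g.
     u \<in> W1p_0 p \<Omega> \<and> g \<in> Lp_space p (lebesgue_on \<Omega>) \<and>
     has_weak_gradient \<Omega> u g \<and> Lp_norm q (lebesgue_on \<Omega>) u = 1}"

lemma Lambda_pq_eq_Inf: "Lambda_pq p q \<Omega> = Inf (energies p q \<Omega>)"
  by (simp add: Lambda_pq_def energies_def)

lemma energies_nonneg: "y \<in> energies p q \<Omega> \<Longrightarrow> 0 \<le> y"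
  unfolding energies_def by auto

text \<open>The mollified cone, divided by its \<open>L\<^sup>q\<close> norm. That norm is at least \<open>r \<mu> powr (1/q)\<close>, where \<open>\<mu>\<close> is the measure of the
ball on which the cone exceeds \<open>r\<close>; neither \<open>r\<close> nor \<open>\<mu>\<close> depends on \<open>p\<close> and \<open>q\<close>. The lemma also shows that the infimum
is taken over a nonempty set.\<close>

lemma energy_of_cone:
  fixes \<Omega> :: "'a::euclidean_space set"
  assumes \<Omega>: "open \<Omega>" "bounded \<Omega>" "\<Omega> \<noteq> {}" and r: "0 < r" "r < inradius \<Omega>"
  obtains \<mu> where "\<mu> > 0" "\<And>p q. 1 < q \<Longrightarrow> 1 < p \<Longrightarrow>
    \<exists>y\<in>energies p q \<Omega>. y \<le> measure lebesgue \<Omega> * (1 / (r * \<mu> powr (1 / q))) powr p"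
proof -
  let ?M = "lebesgue_on \<Omega>"
  let ?V = "measure lebesgue \<Omega>"
  have \<Omega>': "\<Omega> \<in> sets lebesgue" using \<Omega>(1) by simp
  interpret finite_measure ?M by (rule finite_measure_lebesgue_on_bounded[OF \<Omega>(1,2)])
  obtain \<phi> x0 s where \<phi>: "test_fun \<Omega> \<phi>" "\<And>x. norm (gradient \<phi> x) \<le> 1"
    and s: "s > 0" "ball x0 s \<subseteq> \<Omega>" "\<And>x. x \<in> ball x0 s \<Longrightarrow> r \<le> \<phi> x"
    using smooth_cone_exists[OF \<Omega> r(2)] by metis
  define \<mu> where "\<mu> = measure lebesgue (ball x0 s)"
  have \<mu>: "\<mu> > 0" unfolding \<mu>_def by (rule measure_open_pos) (use s in auto)
  have element: "\<exists>y\<in>energies p q \<Omega>. y \<le> ?V * (1 / (r * \<mu> powr (1 / q))) powr p" if pq: "1 < q" "1 < p" for p q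
  proof -
    define c where "c = 1 / Lp_norm q ?M \<phi>"
    have norm_ge: "r * \<mu> powr (1 / q) \<le> Lp_norm q ?M \<phi>"
    proof -
      have "r powr q * \<mu> = (LINT x|?M. indicator (ball x0 s) x * r powr q)"
        using \<Omega>' s(2) by (simp add: \<mu>_def measure_restrict_space mult.commute Int_absorb2)
      also have "\<dots> \<le> (LINT x|?M. norm (\<phi> x) powr q)"
      proof (rule integral_mono_AE')
        show "integrable ?M (\<lambda>x. norm (\<phi> x) powr q)"
          using test_fun_Lp_space(1)[OF \<Omega>(1) \<phi>(1), of q] pq by (simp add: Lp_space_def)
        show "AE x in ?M. indicator (ball x0 s) x * r powr q \<le> norm (\<phi> x) powr q"
        proof (intro AE_I2)
          fix x
          show "indicator (ball x0 s) x * r powr q \<le> norm (\<phi> x) powr q"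
          proof (cases "x \<in> ball x0 s")
            case True
            then have "r \<le> norm (\<phi> x)" using s(3)[OF True] by simp
            then have "r powr q \<le> norm (\<phi> x) powr q" using r(1) pq by (intro powr_mono2) auto
            then show ?thesis using True by simp
          qed simp
        qed
      qed simp
      finally have "(r powr q * \<mu>) powr (1 / q) \<le> Lp_norm q ?M \<phi>"
        unfolding Lp_norm_def using pq \<mu> by (intro powr_mono2) auto
      then show ?thesis using pq r(1) \<mu> by (simp add: powr_mult powr_powr)
    qed
    have rm: "0 < r * \<mu> powr (1 / q)" using r(1) \<mu> by simp
    have c: "0 < c" "c \<le> 1 / (r * \<mu> powr (1 / q))"
      using norm_ge rm by (auto simp: c_def intro!: divide_left_mono)
    let ?u = "\<lambda>x. c * \<phi> x"
    have sm: "smooth \<phi>" using \<phi>(1) by (simp add: test_fun_def)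
    have u: "test_fun \<Omega> ?u"
      using \<phi>(1) c(1) by (auto simp: test_fun_def intro!: Ck_fun_mult Ck_fun_const)
    have grad: "gradient ?u x = c *\<^sub>R gradient \<phi> x" for x
    proof (rule GDERIV_unique[OF smooth_gradient])
      show "smooth ?u" using u by (simp add: test_fun_def)
      show "GDERIV ?u x :> c *\<^sub>R gradient \<phi> x"
        using GDERIV_mult[OF GDERIV_const[of c] smooth_gradient[OF sm]] by simp
    qed
    have "Lp_norm q ?M ?u = c * Lp_norm q ?M \<phi>"
      using c(1) pq by (simp add: Lp_norm_def abs_mult powr_mult powr_powr)
    also have "\<dots> = 1" using norm_ge rm by (simp add: c_def)
    finally have "Lp_norm q ?M ?u = 1" .
    moreover have "?u \<in> W1p_0 p \<Omega>" by (rule test_fun_W1p_0[OF \<Omega>(1) u]) (use pq in simp)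
    moreover have "gradient ?u \<in> Lp_space p ?M"
      by (rule test_fun_Lp_space(2)[OF \<Omega>(1) u]) (use pq in simp)
    ultimately have mem: "(LINT x|?M. norm (gradient ?u x) powr p) \<in> energies p q \<Omega>"
      unfolding energies_def using test_fun_weak_gradient[OF \<Omega>(1) u] by blast
    have "(LINT x|?M. norm (gradient ?u x) powr p) \<le> (LINT x|?M. (1 / (r * \<mu> powr (1 / q))) powr p)"
    proof (rule integral_mono_AE')
      show "AE x in ?M. norm (gradient ?u x) powr p \<le> (1 / (r * \<mu> powr (1 / q))) powr p"
      proof (intro AE_I2 powr_mono2)
        fix x
        have "norm (gradient ?u x) \<le> c * 1"
          using c(1) \<phi>(2)[of x] by (simp add: grad)
        then show "norm (gradient ?u x) \<le> 1 / (r * \<mu> powr (1 / q))" using c(2) by linarith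
      qed (use pq in auto)
    qed auto
    then show ?thesis
      using mem \<Omega>' by (intro bexI[OF _ mem]) (simp add: measure_restrict_space)
  qed
  show ?thesis by (rule that[OF \<mu> element])
qed

lemma Lambda_pq_root_upper:
  fixes \<Omega> :: "'a::euclidean_space set"
  assumes \<Omega>: "open \<Omega>" "bounded \<Omega>" "\<Omega> \<noteq> {}" and r: "0 < r" "r < inradius \<Omega>"
  obtains \<mu> where "\<mu> > 0" "\<And>p q. 1 < q \<Longrightarrow> 1 < p \<Longrightarrow>
    Lambda_pq p q \<Omega> powr (1 / p) \<le> measure lebesgue \<Omega> powr (1 / p) / (r * \<mu> powr (1 / q))"
proof -
  let ?V = "measure lebesgue \<Omega>"
  obtain \<mu> where \<mu>: "\<mu> > 0" and element: "\<And>p q. 1 < q \<Longrightarrow> 1 < p \<Longrightarrow>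
      \<exists>y\<in>energies p q \<Omega>. y \<le> ?V * (1 / (r * \<mu> powr (1 / q))) powr p"
    using energy_of_cone[OF \<Omega> r] by blast
  show ?thesis
  proof (rule that[OF \<mu>])
    fix p q :: real assume pq: "1 < q" "1 < p"
    have rm: "0 < r * \<mu> powr (1 / q)" using r(1) \<mu> by simp
    obtain y where y: "y \<in> energies p q \<Omega>" "y \<le> ?V * (1 / (r * \<mu> powr (1 / q))) powr p"
      using element[OF pq] by blast
    have "Lambda_pq p q \<Omega> \<le> y" unfolding Lambda_pq_eq_Inf
      by (intro cInf_lower y(1) bdd_belowI[of _ 0] energies_nonneg)
    moreover have "0 \<le> Lambda_pq p q \<Omega>"
      unfolding Lambda_pq_eq_Inf using y(1) energies_nonneg by (intro cInf_greatest) auto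
    ultimately have "Lambda_pq p q \<Omega> powr (1 / p) \<le> (?V * (1 / (r * \<mu> powr (1 / q))) powr p) powr (1 / p)"
      using y(2) pq by (intro powr_mono2) auto
    also have "\<dots> = ?V powr (1 / p) / (r * \<mu> powr (1 / q))"
      using rm pq by (simp add: powr_mult powr_powr)
    finally show "Lambda_pq p q \<Omega> powr (1 / p) \<le> ?V powr (1 / p) / (r * \<mu> powr (1 / q))" .
  qed
qed

text \<open>For an admissible \<open>u\<close> with gradient \<open>g\<close>, the supremum bound gives
\<open>1 = \<parallel>u\<parallel>\<^sub>q \<le> \<bar>\<Omega>\<bar> powr (1/q) \<parallel>u\<parallel>\<^sub>\<infinity> \<le> \<bar>\<Omega>\<bar> powr (1/q) C \<parallel>g\<parallel>\<^sub>p\<close>.\<close>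

lemma Lambda_pq_root_lower:
  fixes \<Omega> :: "'a::euclidean_space set"
  assumes \<Omega>: "open \<Omega>" "bounded \<Omega>" "\<Omega> \<noteq> {}"
    and pq: "1 < q" "1 < p" "real DIM('a) < p" and \<delta>: "0 < \<delta>"
  shows "1 / (measure lebesgue \<Omega> powr (1 / q) * ((inradius \<Omega> + 2 * \<delta>) * box_factor TYPE('a) \<delta> p))
    \<le> Lambda_pq p q \<Omega> powr (1 / p)"
proof -
  let ?M = "lebesgue_on \<Omega>"
  let ?V = "measure lebesgue \<Omega>"
  have V: "0 < ?V" by (rule measure_open_pos[OF \<Omega>])
  define C where "C = (inradius \<Omega> + 2 * \<delta>) * box_factor TYPE('a) \<delta> p"
  have C: "C > 0"
  proof -
    have "0 < measure lborel (cbox 0 ((\<delta> / DIM('a)) *\<^sub>R (One::'a)))"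
      using \<delta> by (intro content_pos_lt) auto
    then show ?thesis
      using inradius_pos[OF \<Omega>] \<delta> pq by (simp add: C_def box_factor_def)
  qed
  define L where "L = 1 / (?V powr (1 / q) * C)"
  have L: "L > 0" using V C by (simp add: L_def)
  have "L powr p \<le> y" if yQ: "y \<in> energies p q \<Omega>" for y
  proof -
    obtain u g where y: "y = (LINT x|?M. norm (g x) powr p)" and u: "u \<in> W1p_0 p \<Omega>" "Lp_norm q ?M u = 1"
      and g: "g \<in> Lp_space p ?M" "has_weak_gradient \<Omega> u g"
      using yQ unfolding energies_def by blast
    have "L \<le> N" if N: "Lp_norm p ?M g < N" for N
    proof -
      have "0 \<le> C * N" using C N Lp_norm_nonneg[of p ?M g] by simp
      moreover have "AE x in ?M. \<bar>u x\<bar> \<le> C * N"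
        unfolding C_def by (rule W1p_0_AE_bound[OF \<Omega> pq(3) \<delta> u(1) g N])
      ultimately have "1 \<le> ?V powr (1 / q) * (C * N)"
        using Lp_norm_le_of_AE[OF \<Omega>(1,2), of q u "C * N"] pq(1) u(2) by simp
      then show ?thesis using V C by (simp add: L_def field_simps)
    qed
    then have "L \<le> Lp_norm p ?M g" by (rule dense_ge)
    then have "L powr p \<le> Lp_norm p ?M g powr p" using L pq by (intro powr_mono2) auto
    then show ?thesis using pq by (simp add: y Lp_norm_powr)
  qed
  moreover have nonempty: "energies p q \<Omega> \<noteq> {}"
  proof -
    have "0 < inradius \<Omega> / 2" "inradius \<Omega> / 2 < inradius \<Omega>" using inradius_pos[OF \<Omega>] by auto
    then obtain \<mu> where "\<And>p q. 1 < q \<Longrightarrow> 1 < p \<Longrightarrow>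
        \<exists>y\<in>energies p q \<Omega>. y \<le> ?V * (1 / (inradius \<Omega> / 2 * \<mu> powr (1 / q))) powr p"
      using energy_of_cone[OF \<Omega>] by blast
    from this[OF pq(1,2)] show ?thesis by blast
  qed
  ultimately have "L powr p \<le> Lambda_pq p q \<Omega>"
    unfolding Lambda_pq_eq_Inf using nonempty by (intro cInf_greatest) auto
  then have "(L powr p) powr (1 / p) \<le> Lambda_pq p q \<Omega> powr (1 / p)"
    using pq by (intro powr_mono2) auto
  then show "1 / (?V powr (1 / q) * ((inradius \<Omega> + 2 * \<delta>) * box_factor TYPE('a) \<delta> p))
      \<le> Lambda_pq p q \<Omega> powr (1 / p)"
    using L pq by (simp add: powr_powr L_def C_def)
qed

section \<open>Passage to the limit\<close>

lemma powr_inverse_tendsto_1: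
  fixes c :: real
  assumes "c > 0" "filterlim f at_top F"
  shows "((\<lambda>x. c powr (1 / f x)) \<longlongrightarrow> 1) F" "((\<lambda>x. c powr (- 1 / f x)) \<longlongrightarrow> 1) F"
proof -
  have l: "((\<lambda>x. k / f x) \<longlongrightarrow> 0) F" for k :: real
    by (rule real_tendsto_divide_at_top[OF tendsto_const assms(2)])
  show "((\<lambda>x. c powr (1 / f x)) \<longlongrightarrow> 1) F"
    using tendsto_powr[OF tendsto_const[of c] l[of 1]] assms(1) by simp
  show "((\<lambda>x. c powr (- 1 / f x)) \<longlongrightarrow> 1) F"
    using tendsto_powr[OF tendsto_const[of c] l[of "- 1"]] assms(1) by simp
qed

lemma box_factor_tendsto_1:
  assumes "\<delta> > 0" "filterlim f at_top F"
  shows "((\<lambda>x. box_factor TYPE('a::euclidean_space) \<delta> (f x)) \<longlongrightarrow> 1) F"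
proof -
  have "0 < measure lborel (cbox 0 ((\<delta> / DIM('a)) *\<^sub>R (One::'a)))"
    using assms(1) by (intro content_pos_lt) auto
  note l1 = powr_inverse_tendsto_1(2)[OF this assms(2)]
  have l2: "((\<lambda>x. 1 - DIM('a) / f x) \<longlongrightarrow> 1 - 0) F"
    by (intro tendsto_intros real_tendsto_divide_at_top[OF tendsto_const assms(2)])
  show ?thesis unfolding box_factor_def using tendsto_divide[OF l1 l2] by simp
qed

theorem theorem1p1:
  fixes \<Omega> :: "'a::euclidean_space set"
  assumes "open \<Omega>" "connected \<Omega>" "bounded \<Omega>" "\<Omega> \<noteq> {}"
  shows "((\<lambda>(p, q). Lambda_pq p q \<Omega> powr (1 / p)) \<longlongrightarrow> lambda_1inf \<Omega>)
           (inf (at_top \<times>\<^sub>F at_top) (principal {(p, q). 1 < q \<and> q < p}))"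
proof -
  note \<Omega> = assms(1,3,4)
  let ?F = "inf (at_top \<times>\<^sub>F at_top) (principal {(p, q). 1 < q \<and> q < p}) :: (real \<times> real) filter"
  let ?V = "measure lebesgue \<Omega>" and ?R = "inradius \<Omega>"
  have V: "0 < ?V" by (rule measure_open_pos[OF \<Omega>])
  have R: "0 < ?R" by (rule inradius_pos[OF \<Omega>])
  have fst: "filterlim fst at_top ?F" and snd: "filterlim snd at_top ?F"
    by (rule filterlim_mono[OF filterlim_fst order_refl inf_le1],
        rule filterlim_mono[OF filterlim_snd order_refl inf_le1])
  have region: "\<forall>\<^sub>F x in ?F. 1 < snd x \<and> snd x < fst x"
    by (simp add: eventually_inf_principal case_prod_beta)
  have large: "\<forall>\<^sub>F x in ?F. real DIM('a) < fst x"
    using fst by (simp add: filterlim_at_top_dense)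
  \<comment> \<open>The parameters \<open>\<delta>\<close> and \<open>r\<close> are fixed before \<open>p\<close> and \<open>q\<close> tend to infinity.\<close>
  have "((\<lambda>x. Lambda_pq (fst x) (snd x) \<Omega> powr (1 / fst x)) \<longlongrightarrow> 1 / ?R) ?F"
  proof (rule order_tendstoI)
    fix a assume a: "a < 1 / ?R"
    have "((\<lambda>\<delta>. 1 / (?R + 2 * \<delta>)) \<longlongrightarrow> 1 / (?R + 2 * 0)) (at_right 0)"
      by (intro tendsto_intros) (use R in auto)
    then have "\<forall>\<^sub>F \<delta> in at_right 0. a < 1 / (?R + 2 * \<delta>)"
      by (rule order_tendstoD) (use a in simp)
    with eventually_at_right_less[of "0::real"]
    have "\<forall>\<^sub>F \<delta> in at_right 0. 0 < \<delta> \<and> a < 1 / (?R + 2 * \<delta>)" by (rule eventually_conj)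
    then obtain \<delta> where \<delta>: "0 < \<delta>" "a < 1 / (?R + 2 * \<delta>)"
      using eventually_happens[of _ "at_right (0::real)"] by auto
    have "((\<lambda>x. 1 / (?V powr (1 / snd x) * ((?R + 2 * \<delta>) * box_factor TYPE('a) \<delta> (fst x))))
        \<longlongrightarrow> 1 / (1 * ((?R + 2 * \<delta>) * 1))) ?F"
      by (intro tendsto_intros powr_inverse_tendsto_1(1)[OF V snd] box_factor_tendsto_1[OF \<delta>(1) fst])
        (use R \<delta> in auto)
    then have "\<forall>\<^sub>F x in ?F. a < 1 / (?V powr (1 / snd x) * ((?R + 2 * \<delta>) * box_factor TYPE('a) \<delta> (fst x)))"
      by (rule order_tendstoD) (use \<delta> in simp)
    then show "\<forall>\<^sub>F x in ?F. a < Lambda_pq (fst x) (snd x) \<Omega> powr (1 / fst x)"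
      using region large
    proof eventually_elim
      case (elim x)
      then have "1 < snd x" "1 < fst x" "real DIM('a) < fst x" by auto
      from order_less_le_trans[OF elim(1) Lambda_pq_root_lower[OF \<Omega> this \<delta>(1)]] show ?case .
    qed
  next
    fix a assume a: "1 / ?R < a"
    then have "0 < a" using R by (meson order.strict_trans zero_less_divide_1_iff)
    then have "1 / a < ?R" using a R by (simp add: field_simps)
    then obtain r where r: "1 / a < r" "r < ?R" using dense by blast
    then have r0: "0 < r" using \<open>0 < a\<close> by (meson order.strict_trans zero_less_divide_1_iff)
    have ra: "1 / r < a" using r(1) r0 \<open>0 < a\<close> by (simp add: field_simps)
    obtain \<mu> where \<mu>: "\<mu> > 0" and up: "\<And>p q. 1 < q \<Longrightarrow> 1 < p \<Longrightarrow>
      Lambda_pq p q \<Omega> powr (1 / p) \<le> ?V powr (1 / p) / (r * \<mu> powr (1 / q))"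
      using Lambda_pq_root_upper[OF \<Omega> r0 r(2)] by blast
    have "((\<lambda>x. ?V powr (1 / fst x) / (r * \<mu> powr (1 / snd x))) \<longlongrightarrow> 1 / (r * 1)) ?F"
      by (intro tendsto_intros powr_inverse_tendsto_1(1)[OF V fst] powr_inverse_tendsto_1(1)[OF \<mu> snd])
        (use r0 in auto)
    then have "\<forall>\<^sub>F x in ?F. ?V powr (1 / fst x) / (r * \<mu> powr (1 / snd x)) < a"
      by (rule order_tendstoD) (use ra in simp)
    then show "\<forall>\<^sub>F x in ?F. Lambda_pq (fst x) (snd x) \<Omega> powr (1 / fst x) < a"
      using region
    proof eventually_elim
      case (elim x)
      then have "1 < snd x" "1 < fst x" by auto
      from order_le_less_trans[OF up[OF this] elim(1)] show ?case .
    qed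
  qed
  moreover have "(\<lambda>(p, q). Lambda_pq p q \<Omega> powr (1 / p))
      = (\<lambda>x. Lambda_pq (fst x) (snd x) \<Omega> powr (1 / fst x))"
    by (simp add: case_prod_unfold)
  ultimately show ?thesis by (simp only: lambda_1inf_eq[OF \<Omega>])
qed

end
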